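(* For every integer $d\ge 2$, the dual polytope of a cyclic $d$-polytope with $d+2$ vertices is $\lfloor d/2\rfloor$-linked.
   Context: The moment curve in $\mathbb{R}^d$ is $x(t)=(t,t^2,\ldots,t^d)$, $t\in\mathbb{R}$. For $n>d$, a cyclic $d$-polytope with $n$ vertices is the convex hull of $n$ distinct points on the moment curve in $\mathbb{R}^d$; its face lattice does not depend on the choice of the points. For a $d$-polytope $P\subset\mathbb{R}^d$ containing the origin in its interior, the dual polytope is $P^*=\{y\in\mathbb{R}^d : x\cdot y\le 1 \text{ for all } x\in P\}$; if $P$ does not contain the origin in its interior, it is first translated so that it does (this does not affect the face lattice of $P^*$, which is the face lattice of $P$ with inclusion reversed). The graph of a polytope is the undirected graph formed by its vertices and edges; thus the graph of $P^*$ is isomorphic to the graph on the facets of $P$ in which two facets are adjacent if they share a $(d-2)$-face. A polytope is called $k$-linked if its graph is $k$-linked. For an integer $k\ge 0$, a graph $G$ is $k$-linked if it has at least $2k$ vertices and, for every set $X$ of exactly $2k$ distinct vertices of $G$ and every partition of $X$ into pairs $\{s_1,t_1\},\ldots,\{s_k,t_k\}$, there exist $k$ pairwise vertex-disjoint paths $L_1,\ldots,L_k$ in $G$ such that $L_i$ joins $s_i$ to $t_i$ for each $i\in\{1,\ldots,k\}$. *)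

theory Defs
  imports "HOL-Analysis.Analysis" "Graph_Theory.Graph_Theory"
begin

text \<open>
  Undirected graphs are represented as symmetric digraphs without loops, as in the locale
  \<open>pair_graph\<close>. A path is a list of distinct vertices (\<open>vpath\<close>); a list with one element is the
  trivial path.
\<close>

text \<open>
  As \<open>X\<close> has \<open>2 * k\<close> elements and is covered by the \<open>s i\<close> and \<open>t i\<close> with \<open>i < k\<close>, these are pairwise
  distinct, so the sets \<open>{s i, t i}\<close> form a partition of \<open>X\<close> into pairs. Every such partition arises
  in this way.
\<close>
definition k_linked :: "nat \<Rightarrow> 'a pair_pre_digraph \<Rightarrow> bool" where
  "k_linked k G \<longleftrightarrow>
     2 * k \<le> card (pverts G) \<and>
     (\<forall>X s t. X \<subseteq> pverts G \<and> card X = 2 * k \<and> X = s ` {..<k} \<union> t ` {..<k} \<longrightarrow>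
        (\<exists>L. (\<forall>i<k. vpath (L i) (with_proj G) \<and> hd (L i) = s i \<and> last (L i) = t i) \<and>
             (\<forall>i<k. \<forall>j<k. i \<noteq> j \<longrightarrow> set (L i) \<inter> set (L j) = {})))"

definition polytope_graph :: "'a::euclidean_space set \<Rightarrow> 'a pair_pre_digraph" where
  "polytope_graph P =
     \<lparr> pverts = {v. v extreme_point_of P},
       parcs = {(u, v). u extreme_point_of P \<and> v extreme_point_of P \<and>
                        closed_segment u v edge_of P} \<rparr>"

lemma pair_graph_polytope_graph:
  assumes "polytope P"
  shows "pair_graph (polytope_graph P)"
proof -
  let ?V = "{v. v extreme_point_of P}"
  have fin: "finite ?V"
    using assms finite_polyhedron_extreme_points polytope_imp_polyhedron by blast
  have sub: "parcs (polytope_graph P) \<subseteq> ?V \<times> ?V"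
    by (auto simp: polytope_graph_def)
  have "finite (parcs (polytope_graph P))"
    using finite_subset[OF sub] fin by simp
  then show ?thesis
    using fin
    by unfold_locales
      (auto simp: polytope_graph_def symmetric_def sym_def closed_segment_commute edge_of_def
         arcs_ends_def arc_to_ends_def)
qed

definition linked_polytope :: "nat \<Rightarrow> 'a::euclidean_space set \<Rightarrow> bool" where
  "linked_polytope k P \<longleftrightarrow> k_linked k (polytope_graph P)"

text \<open>The case of interest is that the origin lies in the interior of \<open>P\<close>.\<close>
definition dual_polytope :: "'a::euclidean_space set \<Rightarrow> 'a set" where
  "dual_polytope P = {y. \<forall>x\<in>P. x \<bullet> y \<le> 1}"

text \<open>
  Here \<open>d = CARD('n)\<close>, and the bijection \<open>e\<close> from \<open>'n\<close> to \<open>{1..d}\<close> numbers the coordinates: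
  coordinate \<open>i\<close> of \<open>real ^ 'n\<close> is coordinate number \<open>e i\<close> of \<open>d\<close>-dimensional Euclidean space.
\<close>
definition moment_curve :: "('n \<Rightarrow> nat) \<Rightarrow> real \<Rightarrow> real ^ 'n::finite" where
  "moment_curve e t = (\<chi> i. t ^ e i)"

definition cyclic_polytope :: "('n \<Rightarrow> nat) \<Rightarrow> nat \<Rightarrow> (real ^ 'n::finite) set \<Rightarrow> bool" where
  "cyclic_polytope e n P \<longleftrightarrow>
     CARD('n) < n \<and>
     (\<exists>S. S \<subseteq> range (moment_curve e) \<and> finite S \<and> card S = n \<and> P = convex hull S)"

end

theory Submission
  imports Defs
begin

text \<open>
  Put \<open>d = CARD('n)\<close> and \<open>k = d div 2\<close>. Up to scaling, \<open>d + 2\<close> points on the moment curve satisfy one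
  affine relation, and all its coefficients are nonzero. Pairing it with the square of a polynomial
  that vanishes at the nodes of one sign shows that each of the two sign classes \<open>A\<close> and \<open>B\<close> has more
  than \<open>k\<close> elements. A vertex of the dual polytope is given by the two facets it avoids, one from \<open>A\<close>
  and one from \<open>B\<close>, and two vertices sharing one of these are adjacent; so the graph contains the
  rook's graph on \<open>A \<times> B\<close>.

  On an \<open>a \<times> b\<close> rook's graph with \<open>a, b > k\<close>, any \<open>k\<close> pairs are linked by induction on \<open>k\<close>: some
  pairs are linked inside a few rows and columns, as many of each as there are pairs, and the
  remaining terminals leave these lines in one step. A pair lying in one row needs only that row,
  unless some column is full; that column then contains a pair as well and is used instead. If no
  pair lies in a line and a corner of a pair (the intersection of the row of one terminal with the
  column of the other) is free, then the pair is linked through it. If all corners are occupied,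
  every line meeting a terminal contains at least two, so there are empty rows and columns through
  which one can link.
\<close>

subsection \<open>Linking pairs in a rook's graph\<close>

text \<open>Rook adjacency made reflexive, so that a terminal that stays and one that steps along a
  line satisfy the same condition.\<close>

definition aligned :: "('a \<times> 'a) rel" where
  "aligned = {(u, v). fst u = fst v \<or> snd u = snd v}"

text \<open>Pairs are linked by disjoint sets of cells rather than by paths; paths are extracted
  only in \<open>connected_in_vpath\<close>.\<close>

definition connected_in :: "('a \<times> 'a) set \<Rightarrow> 'a \<times> 'a \<Rightarrow> 'a \<times> 'a \<Rightarrow> bool" where
  "connected_in V u v \<longleftrightarrow> u \<in> V \<and> v \<in> V \<and> (u, v) \<in> (Restr aligned V)\<^sup>*"

lemma connected_in_step: "u \<in> V \<Longrightarrow> v \<in> V \<Longrightarrow> (u, v) \<in> aligned \<Longrightarrow> connected_in V u v"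
  by (auto simp: connected_in_def)

lemma connected_in_trans: "connected_in V u v \<Longrightarrow> connected_in V v w \<Longrightarrow> connected_in V u w"
  by (auto simp: connected_in_def)

lemma connected_in_mono:
  assumes "connected_in V u v" "V \<subseteq> W"
  shows "connected_in W u v"
proof -
  have "(Restr aligned V)\<^sup>* \<subseteq> (Restr aligned W)\<^sup>*"
    using assms(2) by (intro rtrancl_mono) auto
  then show ?thesis using assms by (auto simp: connected_in_def)
qed

lemma connected_in_sym:
  assumes "connected_in V u v"
  shows "connected_in V v u"
proof -
  have "sym (Restr aligned V)"
    by (auto simp: sym_def aligned_def)
  then have "sym ((Restr aligned V)\<^sup>*)"
    by (rule sym_rtrancl)
  then show ?thesis using assms by (auto simp: connected_in_def dest: symD)
qed

lemma connected_in_swap: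
  assumes "connected_in V u v"
  shows "connected_in (prod.swap ` V) (prod.swap u) (prod.swap v)"
proof -
  have "(prod.swap u, prod.swap v) \<in> (Restr aligned (prod.swap ` V))\<^sup>*"
    if "(u, v) \<in> (Restr aligned V)\<^sup>*"
    using that
  proof (induction rule: rtrancl_induct)
    case (step y z)
    then have "(prod.swap y, prod.swap z) \<in> Restr aligned (prod.swap ` V)"
      by (auto simp: aligned_def)
    then show ?case using step.IH by (rule rtrancl_into_rtrancl[rotated])
  qed auto
  then show ?thesis using assms by (auto simp: connected_in_def)
qed

lemma connected_in_three:
  assumes "(u, w) \<in> aligned" "(w, v) \<in> aligned" "{u, w, v} \<subseteq> V"
  shows "connected_in V u v"
  using assms by (auto intro: connected_in_trans[of V u w v] connected_in_step)

lemma connected_in_four: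
  assumes "(u, w) \<in> aligned" "(w, w') \<in> aligned" "(w', v) \<in> aligned" "{u, w, w', v} \<subseteq> V"
  shows "connected_in V u v"
  using assms
  by (auto intro: connected_in_trans[of V u w' v] connected_in_three connected_in_step)

text \<open>The two terminals of pair \<open>i\<close> are \<open>x (i, False)\<close> and \<open>x (i, True)\<close>.\<close>

definition linked :: "'i set \<Rightarrow> 'a set \<Rightarrow> 'a set \<Rightarrow> ('i \<times> bool \<Rightarrow> 'a \<times> 'a) \<Rightarrow> bool" where
  "linked I R C x \<longleftrightarrow>
     (\<exists>V. (\<forall>i\<in>I. V i \<subseteq> R \<times> C \<and> connected_in (V i) (x (i, False)) (x (i, True))) \<and>
          (\<forall>i\<in>I. \<forall>j\<in>I. i \<noteq> j \<longrightarrow> V i \<inter> V j = {}))"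

text \<open>The invariant of the induction: the strict inequalities survive as long as no more rows,
  and no more columns, are deleted than pairs are linked.\<close>

definition terminals :: "'i set \<Rightarrow> 'a set \<Rightarrow> 'a set \<Rightarrow> ('i \<times> bool \<Rightarrow> 'a \<times> 'a) \<Rightarrow> bool" where
  "terminals I R C x \<longleftrightarrow>
     finite I \<and> finite R \<and> finite C \<and> card I < card R \<and> card I < card C \<and>
     inj_on x (I \<times> UNIV) \<and> x ` (I \<times> UNIV) \<subseteq> R \<times> C"

lemma terminals_swap: "terminals I R C x \<Longrightarrow> terminals I C R (prod.swap \<circ> x)"
  by (auto simp: terminals_def inj_on_def image_subset_iff mem_Times_iff prod_eq_iff)

lemma linked_swap:
  assumes "linked I C R (prod.swap \<circ> x)"
  shows "linked I R C x"
proof -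
  obtain V where V: "\<And>i. i \<in> I \<Longrightarrow> V i \<subseteq> C \<times> R"
      "\<And>i. i \<in> I \<Longrightarrow> connected_in (V i) (prod.swap (x (i, False))) (prod.swap (x (i, True)))"
      "\<And>i j. i \<in> I \<Longrightarrow> j \<in> I \<Longrightarrow> i \<noteq> j \<Longrightarrow> V i \<inter> V j = {}"
    using assms unfolding linked_def o_def by metis
  have "prod.swap ` V i \<subseteq> R \<times> C" if "i \<in> I" for i
    using V(1)[OF that] by auto
  moreover have "connected_in (prod.swap ` V i) (x (i, False)) (x (i, True))" if "i \<in> I" for i
    using connected_in_swap[OF V(2)[OF that]] by simp
  moreover have "prod.swap ` V i \<inter> prod.swap ` V j = {}" if "i \<in> I" "j \<in> I" "i \<noteq> j" for i j
    using V(3)[OF that] by (metis image_Int image_empty inj_swap)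
  ultimately show ?thesis unfolding linked_def by (intro exI[of _ "\<lambda>i. prod.swap ` V i"]) auto
qed

text \<open>The induction step common to several cases. The pairs in \<open>J\<close> are linked off
  the smaller board \<open>R' \<times> C'\<close>; every other terminal steps to its position under
  \<open>x'\<close> on that board, where the remaining pairs are linked. Terminals already there
  stay, so that no other pair can run through them.\<close>

lemma linked_reduce:
  assumes x: "x ` (I \<times> UNIV) \<subseteq> R \<times> C"
    and sub: "J \<subseteq> I" "R' \<subseteq> R" "C' \<subseteq> C"
    and V: "\<And>j. j \<in> J \<Longrightarrow> V j \<subseteq> R \<times> C - R' \<times> C'"
           "\<And>j. j \<in> J \<Longrightarrow> connected_in (V j) (x (j, False)) (x (j, True))"
           "\<And>i j. i \<in> J \<Longrightarrow> j \<in> J \<Longrightarrow> i \<noteq> j \<Longrightarrow> V i \<inter> V j = {}"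
           "\<And>i b j. i \<in> I - J \<Longrightarrow> j \<in> J \<Longrightarrow> x (i, b) \<notin> V j"
    and inj: "inj_on x (I \<times> UNIV)"
    and x': "\<And>i b. i \<in> I - J \<Longrightarrow> (x (i, b), x' (i, b)) \<in> aligned"
            "\<And>i b. i \<in> I - J \<Longrightarrow> x (i, b) \<in> R' \<times> C' \<Longrightarrow> x' (i, b) = x (i, b)"
    and linked: "linked (I - J) R' C' x'"
  shows "linked I R C x"
proof -
  obtain V' where V': "\<And>i. i \<in> I - J \<Longrightarrow> V' i \<subseteq> R' \<times> C'"
      "\<And>i. i \<in> I - J \<Longrightarrow> connected_in (V' i) (x' (i, False)) (x' (i, True))"
      "\<And>i j. i \<in> I - J \<Longrightarrow> j \<in> I - J \<Longrightarrow> i \<noteq> j \<Longrightarrow> V' i \<inter> V' j = {}"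
    using linked unfolding linked_def by metis
  define W where "W i = (if i \<in> J then V i else V' i \<union> {x (i, False), x (i, True)})" for i
  have mem: "x' (i, b) \<in> V' i" if "i \<in> I - J" for i b
    using V'(2)[OF that] by (cases b) (auto simp: connected_in_def)
  have "W i \<subseteq> R \<times> C" if "i \<in> I" for i
  proof (cases "i \<in> J")
    case False
    then have "V' i \<subseteq> R \<times> C" using V'(1)[of i] that sub by blast
    moreover have "x (i, b) \<in> R \<times> C" for b using x that by blast
    ultimately show ?thesis using False by (simp add: W_def)
  qed (use V(1) in \<open>auto simp: W_def\<close>)
  moreover have "connected_in (W i) (x (i, False)) (x (i, True))" if "i \<in> I" for i
  proof (cases "i \<in> J")
    case False
    then have i: "i \<in> I - J" using that by simp
    have "connected_in (W i) (x' (i, False)) (x' (i, True))"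
      by (rule connected_in_mono[OF V'(2)[OF i]]) (auto simp: W_def False)
    moreover have "connected_in (W i) (x (i, b)) (x' (i, b))" for b
      using mem[OF i, of b] x'(1)[OF i, of b] False
      by (cases b) (auto simp: W_def intro!: connected_in_step)
    ultimately show ?thesis
      by (meson connected_in_sym connected_in_trans)
  qed (use V(2) in \<open>simp add: W_def\<close>)
  moreover have "W i \<inter> W j = {}" if ij: "i \<in> I" "j \<in> I" "i \<noteq> j" for i j
  proof -
    \<comment> \<open>A terminal in \<open>V' j\<close> is on the smaller board, so it is not moved
      and lies in \<open>V' i\<close> too.\<close>
    have a: "x (i, b) \<notin> V' j" if "i \<in> I - J" "j \<in> I - J" "i \<noteq> j" for i j b
      using V'(1)[of j] V'(3)[of i j] mem[of i b] x'(2)[of i b] that by (metis disjoint_iff subsetD)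
    have b: "x (i, b) \<noteq> x (j, b')" for b b'
      using inj ij by (auto simp: inj_on_def)
    have c: "W i \<inter> W j = {}" if "i \<in> J" "j \<in> I - J" for i j
    proof -
      have "V i \<inter> V' j = {}" using V(1)[of i] V'(1)[of j] that by blast
      then show ?thesis using V(4)[of j i] that by (simp add: W_def)
    qed
    show ?thesis
    proof (cases "i \<in> J")
      case True
      then show ?thesis
        using c[of i j] V(3)[of i j] ij by (cases "j \<in> J") (simp_all add: W_def)
    next
      case i: False
      show ?thesis
      proof (cases "j \<in> J")
        case True
        then show ?thesis using c[of j i] i ij by (simp add: Int_commute)
      next
        case False
        then show ?thesis
          using a[of i j] a[of j i] b b[symmetric] i ij V'(3)[of i j] by (simp add: W_def Int_Un_distrib Int_Un_distrib2)
      qed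
    qed
  qed
  ultimately show ?thesis unfolding linked_def by (intro exI[of _ W]) simp
qed

section \<open>Distinct representatives\<close>

text \<open>Serving one agent takes a cell away from at most one other agent, so at every stage at most
  one agent \<open>e\<close> is down to a single cell; that agent is served next.\<close>

lemma distinct_representatives_aux:
  assumes "finite A" "\<And>\<tau>. \<tau> \<in> A \<Longrightarrow> finite (F \<tau>)"
    and "\<And>\<tau>. \<tau> \<in> A \<Longrightarrow> \<tau> \<noteq> e \<Longrightarrow> 2 \<le> card (F \<tau>)"
    and "e \<in> A \<Longrightarrow> F e \<noteq> {}"
    and "\<And>z. card {\<tau> \<in> A. z \<in> F \<tau>} \<le> 2"
  shows "\<exists>f. inj_on f A \<and> (\<forall>\<tau>\<in>A. f \<tau> \<in> F \<tau>)"
  using assms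
proof (induction "card A" arbitrary: A F e)
  case 0
  then show ?case by auto
next
  case (Suc n)
  obtain \<tau>0 where \<tau>0: "\<tau>0 \<in> A" "e \<in> A \<Longrightarrow> \<tau>0 = e"
    using Suc.hyps(2) by (metis all_not_in_conv card.empty nat.distinct(1))
  have "F \<tau>0 \<noteq> {}"
    using Suc.prems(3)[of \<tau>0] Suc.prems(4) \<tau>0 by (cases "\<tau>0 = e") auto
  then obtain z where z: "z \<in> F \<tau>0" by auto
  define B where "B = {\<tau> \<in> A - {\<tau>0}. z \<in> F \<tau>}"
  have "B = {\<tau> \<in> A. z \<in> F \<tau>} - {\<tau>0}" by (auto simp: B_def)
  then have "card B \<le> 1" using Suc.prems(1) Suc.prems(5)[of z] z \<tau>0(1) by simp
  \<comment> \<open>An agent that also wanted \<open>z\<close> may now be down to one cell and takes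
    over the role of \<open>e\<close>.\<close>
  then obtain e' where e': "B \<subseteq> {e'}"
    using Suc.prems(1) card_le_Suc0_iff_eq[of B] by (cases "B = {}") (auto simp: B_def)
  have "\<exists>f. inj_on f (A - {\<tau>0}) \<and> (\<forall>\<tau>\<in>A - {\<tau>0}. f \<tau> \<in> F \<tau> - {z})"
  proof (rule Suc.hyps(1))
    show "n = card (A - {\<tau>0})" using Suc.hyps(2) Suc.prems(1) \<tau>0(1) by simp
    show "2 \<le> card (F \<tau> - {z})" if "\<tau> \<in> A - {\<tau>0}" "\<tau> \<noteq> e'" for \<tau>
    proof -
      have "z \<notin> F \<tau>" using that e' by (auto simp: B_def)
      moreover have "\<tau> \<noteq> e" using that \<tau>0 by auto
      ultimately show ?thesis using Suc.prems(3)[of \<tau>] that by simp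
    qed
    show "F e' - {z} \<noteq> {}" if "e' \<in> A - {\<tau>0}"
    proof -
      have "e' \<noteq> e" using that \<tau>0 by auto
      then have "\<not> card (F e') \<le> card {z}" using Suc.prems(3)[of e'] that by simp
      then show ?thesis by (metis Diff_eq_empty_iff card_mono finite.emptyI finite.insertI)
    qed
    show "card {\<tau> \<in> A - {\<tau>0}. z' \<in> F \<tau> - {z}} \<le> 2" for z'
      by (rule order_trans[OF card_mono Suc.prems(5)[of z']]) (use Suc.prems(1) in auto)
  qed (use Suc.prems in auto)
  then obtain f where f: "inj_on f (A - {\<tau>0})" "\<forall>\<tau>\<in>A - {\<tau>0}. f \<tau> \<in> F \<tau> - {z}" by auto
  have "z \<notin> f ` (A - {\<tau>0})" using f(2) by auto
  then have "inj_on (f(\<tau>0 := z)) A"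
    using f(1) by (auto simp: inj_on_def)
  moreover have "\<forall>\<tau>\<in>A. (f(\<tau>0 := z)) \<tau> \<in> F \<tau>"
    using f z by auto
  ultimately show ?case by blast
qed

lemma distinct_representatives:
  assumes "finite A" "\<And>\<tau>. \<tau> \<in> A \<Longrightarrow> finite (F \<tau>)"
    and "\<And>\<tau>. \<tau> \<in> A \<Longrightarrow> 2 \<le> card (F \<tau>)"
    and "\<And>z. card {\<tau> \<in> A. z \<in> F \<tau>} \<le> 2"
  shows "\<exists>f. inj_on f A \<and> (\<forall>\<tau>\<in>A. f \<tau> \<in> F \<tau>)"
proof -
  have "F \<tau> \<noteq> {}" if "\<tau> \<in> A" for \<tau>
    using assms(3)[OF that] by auto
  then show ?thesis
    \<comment> \<open>Nobody is exceptional at the start, since every agent has two cells; so any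
      value will do for \<open>e\<close>.\<close>
    using assms by (intro distinct_representatives_aux[where e = undefined]) auto
qed

lemma inj_on_extend:
  assumes "finite A" "finite D" "card A \<le> card D" "B \<subseteq> A" "inj_on f B" "f ` B \<subseteq> D"
  obtains g where "inj_on g A" "g ` A \<subseteq> D" "\<And>a. a \<in> B \<Longrightarrow> g a = f a"
proof -
  have fin: "finite B" using assms finite_subset by auto
  have "card (A - B) \<le> card (D - f ` B)"
    using assms fin by (simp add: card_Diff_subset card_image)
  then obtain h where h: "h ` (A - B) \<subseteq> D - f ` B" "inj_on h (A - B)"
    using card_le_inj[of "A - B" "D - f ` B"] assms by auto
  let ?g = "\<lambda>a. if a \<in> B then f a else h a"
  have "inj_on ?g A"
    using h assms(5) by (auto simp: inj_on_def)
  moreover have "?g ` A \<subseteq> D" using h assms by auto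
  ultimately show ?thesis by (intro that[of ?g]) auto
qed


section \<open>Occupied cells and the induction hypothesis\<close>

definition occupied :: "'i set \<Rightarrow> ('i \<times> bool \<Rightarrow> 'a \<times> 'a) \<Rightarrow> ('a \<times> 'a) set" where
  "occupied I x = x ` (I \<times> UNIV)"

text \<open>The induction hypothesis of \<open>terminals_linked\<close>, packaged as a predicate.
  The \<open>itself\<close> argument fixes the type of rows and columns, which \<open>I\<close> does
  not mention.\<close>

definition subsets_linked :: "'i set \<Rightarrow> 'a itself \<Rightarrow> bool" where
  "subsets_linked I A \<longleftrightarrow>
     (\<forall>J R C. \<forall>x :: 'i \<times> bool \<Rightarrow> 'a \<times> 'a. J \<subset> I \<longrightarrow> terminals J R C x \<longrightarrow> linked J R C x)"

lemma card_occupied: "terminals I R C x \<Longrightarrow> card (occupied I x) = 2 * card I"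
  by (simp add: terminals_def occupied_def card_image card_cartesian_product)

lemma terminals_inj:
  assumes "terminals I R C x" "x \<tau> = x \<tau>'" "fst \<tau> \<in> I" "fst \<tau>' \<in> I"
  shows "\<tau> = \<tau>'"
  using assms by (auto simp: terminals_def mem_Times_iff dest!: inj_onD)

lemma terminals_mem: "terminals I R C x \<Longrightarrow> fst \<tau> \<in> I \<Longrightarrow> x \<tau> \<in> R \<times> C"
  by (cases \<tau>) (auto simp: terminals_def)

lemma terminalsI:
  assumes "finite I" "finite R" "finite C" "card I < card R" "card I < card C"
    and "\<And>\<tau> \<tau>'. fst \<tau> \<in> I \<Longrightarrow> fst \<tau>' \<in> I \<Longrightarrow> x \<tau> = x \<tau>' \<Longrightarrow> \<tau> = \<tau>'"
    and "\<And>\<tau>. fst \<tau> \<in> I \<Longrightarrow> x \<tau> \<in> R \<times> C"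
  shows "terminals I R C x"
proof -
  have "inj_on x (I \<times> UNIV)" by (intro inj_onI assms(6)) auto
  moreover have "x ` (I \<times> UNIV) \<subseteq> R \<times> C" using assms(7) by (intro image_subsetI) auto
  ultimately show ?thesis using assms(1-5) by (simp add: terminals_def)
qed

lemma occupiedI: "fst \<tau> \<in> I \<Longrightarrow> x \<tau> \<in> occupied I x"
  by (auto simp: occupied_def mem_Times_iff)

lemma occupied_swap [simp]: "(c, r) \<in> occupied I (prod.swap \<circ> x) \<longleftrightarrow> (r, c) \<in> occupied I x"
  by (force simp: occupied_def image_iff prod_eq_iff)

lemma occupiedE:
  assumes "z \<in> occupied I x"
  obtains \<tau> where "fst \<tau> \<in> I" "x \<tau> = z"
  using assms by (auto simp: occupied_def)

section \<open>Pairs lying in one row or column\<close>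

text \<open>The pair is adjacent inside row \<open>r\<close>, so only this row is deleted. The other
  terminals of the row leave along their columns; these are distinct, so the target cells are
  distinct too.\<close>

lemma linked_row_pair:
  fixes x :: "'i \<times> bool \<Rightarrow> 'a \<times> 'a"
  assumes x: "terminals I R C x" and red: "subsets_linked I TYPE('a)"
    and i: "i \<in> I" "fst (x (i, False)) = r" "fst (x (i, True)) = r"
    and free: "\<And>c. (r, c) \<in> occupied (I - {i}) x \<Longrightarrow> \<exists>\<rho>\<in>R. (\<rho>, c) \<notin> occupied I x"
  shows "linked I R C x"
proof -
  note T = x[unfolded terminals_def]
  obtain h where h: "\<And>c. (r, c) \<in> occupied (I - {i}) x \<Longrightarrow> h c \<in> R \<and> (h c, c) \<notin> occupied I x"
    using free by metis
  define y where "y \<tau> = (if fst (x \<tau>) = r then (h (snd (x \<tau>)), snd (x \<tau>)) else x \<tau>)" for \<tau>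
  note inj = terminals_inj[OF x] and xin = terminals_mem[OF x] and occ = occupiedI[where x = x]
  have R: "r \<in> R" using xin[of "(i, False)"] i by (auto simp: mem_Times_iff)
  have y_row: "h (snd (x \<tau>)) \<in> R - {r}" "y \<tau> \<notin> occupied I x"
      "y \<tau> = (h (snd (x \<tau>)), snd (x \<tau>))"
    if "fst \<tau> \<in> I - {i}" "fst (x \<tau>) = r" for \<tau>
  proof -
    have e: "x \<tau> = (r, snd (x \<tau>))" using that by (simp add: prod_eq_iff)
    \<comment> \<open>The cell \<open>(r, c)\<close> itself is occupied, so the free cell
      \<open>(h c, c)\<close> lies off row \<open>r\<close>.\<close>
    have o: "(r, snd (x \<tau>)) \<in> occupied (I - {i}) x" "(r, snd (x \<tau>)) \<in> occupied I x"
      using occ[of \<tau> "I - {i}"] occ[of \<tau> I] that e by auto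
    show "h (snd (x \<tau>)) \<in> R - {r}" "y \<tau> \<notin> occupied I x"
      "y \<tau> = (h (snd (x \<tau>)), snd (x \<tau>))"
      using h[OF o(1)] o(2) that by (auto simp: y_def)
  qed
  have y_other: "y \<tau> = x \<tau>" if "fst (x \<tau>) \<noteq> r" for \<tau> using that by (simp add: y_def)
  have y_in: "y \<tau> \<in> (R - {r}) \<times> C" if "fst \<tau> \<in> I - {i}" for \<tau>
    using y_row[of \<tau>] y_other[of \<tau>] xin[of \<tau>] that by (cases "fst (x \<tau>) = r") (auto simp: mem_Times_iff)
  have inj_y: "\<tau> = \<tau>'" if m: "fst \<tau> \<in> I - {i}" "fst \<tau>' \<in> I - {i}" and t: "y \<tau> = y \<tau>'" for \<tau> \<tau>'
  proof -
    \<comment> \<open>Moved terminals sit on free cells and unmoved ones on occupied cells, so the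
      two kinds never meet.\<close>
    have "(fst (x \<tau>) = r) = (fst (x \<tau>') = r)"
      using y_row(2)[of \<tau>] y_row(2)[of \<tau>'] y_other[of \<tau>] y_other[of \<tau>'] m t occ[of _ I]
      by (metis DiffD1)
    then have "x \<tau> = x \<tau>'"
      using t by (auto simp: y_def prod_eq_iff split: if_splits)
    then show ?thesis using inj m by blast
  qed
  have "card (I - {i}) + 1 = card I" "card (R - {r}) + 1 = card R"
    using T i(1) R card.remove[of I i] card.remove[of R r] by simp_all
  then have "terminals (I - {i}) (R - {r}) C y"
    using T inj_y y_in by (intro terminalsI) auto
  then have "linked (I - {i}) (R - {r}) C y"
    using red i(1) unfolding subsets_linked_def by blast
  then show ?thesis
  proof (rule linked_reduce[where J = "{i}" and V = "\<lambda>_. {x (i, False), x (i, True)}", rotated -1])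
    show "x ` (I \<times> UNIV) \<subseteq> R \<times> C" "inj_on x (I \<times> UNIV)" using T by auto
    show "{x (i, False), x (i, True)} \<subseteq> R \<times> C - (R - {r}) \<times> C"
      using xin[of "(i, False)"] xin[of "(i, True)"] i by (auto simp: mem_Times_iff)
    show "connected_in {x (i, False), x (i, True)} (x (j, False)) (x (j, True))" if "j \<in> {i}" for j
      using that i by (auto intro!: connected_in_step simp: aligned_def)
    show "x (j, b) \<notin> {x (i, False), x (i, True)}" if "j \<in> I - {i}" for j b
      using inj[of "(j, b)" "(i, False)"] inj[of "(j, b)" "(i, True)"] that i by auto
    show "(x (j, b), y (j, b)) \<in> aligned" for j b
      by (simp add: y_def aligned_def)
    show "y (j, b) = x (j, b)" if "x (j, b) \<in> (R - {r}) \<times> C" for j b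
      using that by (intro y_other) auto
  qed (use i in auto)
qed


text \<open>If a terminal of the row cannot leave, its column \<open>c\<close> is full. With more
  rows than pairs, that column contains both terminals of some pair, and this pair is linked inside
  \<open>c\<close> instead.\<close>

lemma linked_aligned_row:
  fixes x :: "'i \<times> bool \<Rightarrow> 'a \<times> 'a"
  assumes x: "terminals I R C x" and red: "subsets_linked I TYPE('a)"
    and i: "i \<in> I" "fst (x (i, False)) = fst (x (i, True))"
  shows "linked I R C x"
proof (cases "\<forall>c. (fst (x (i, True)), c) \<in> occupied (I - {i}) x \<longrightarrow> (\<exists>\<rho>\<in>R. (\<rho>, c) \<notin> occupied I x)")
  case True
  then show ?thesis using linked_row_pair[OF x red i] by blast
next
  case False
  then obtain c where c: "\<And>\<rho>. \<rho> \<in> R \<Longrightarrow> (\<rho>, c) \<in> occupied I x" by blast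
  have fin: "finite I" "finite R" "finite C" "card I < card R" "card I < card C"
    using x by (auto simp: terminals_def)
  have "\<exists>\<tau>. fst \<tau> \<in> I \<and> x \<tau> = (\<rho>, c)" if "\<rho> \<in> R" for \<rho>
    by (rule occupiedE[OF c[OF that]]) blast
  then have "\<exists>t. \<forall>\<rho>\<in>R. fst (t \<rho>) \<in> I \<and> x (t \<rho>) = (\<rho>, c)" by (intro bchoice) blast
  then obtain t where t: "\<And>\<rho>. \<rho> \<in> R \<Longrightarrow> fst (t \<rho>) \<in> I \<and> x (t \<rho>) = (\<rho>, c)" by blast
  \<comment> \<open>Pigeonhole: the terminals in column \<open>c\<close> outnumber the
    pairs.\<close>
  have "\<not> inj_on (fst \<circ> t) R"
    using t fin card_inj_on_le[of "fst \<circ> t" R I] by (auto simp: image_subset_iff)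
  then obtain \<rho> \<rho>' where \<rho>: "\<rho> \<in> R" "\<rho>' \<in> R" "\<rho> \<noteq> \<rho>'" "fst (t \<rho>) = fst (t \<rho>')"
    by (auto simp: inj_on_def simp del: split_paired_All)
  have "t \<rho> \<noteq> t \<rho>'" using t[OF \<rho>(1)] t[OF \<rho>(2)] \<rho>(3) by auto
  then have "snd (t \<rho>') = (\<not> snd (t \<rho>))" using \<rho>(4) by (auto simp: prod_eq_iff)
  then have eq: "t \<rho>' = (fst (t \<rho>), \<not> snd (t \<rho>))" using \<rho>(4) by (simp add: prod_eq_iff)
  define b where "b = snd (t \<rho>)"
  have "snd (x (fst (t \<rho>), b)) = c"
    using t[OF \<rho>(1)] by (simp add: b_def)
  moreover have "snd (x (fst (t \<rho>), \<not> b)) = c"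
    using t[OF \<rho>(2)] unfolding eq b_def by simp
  ultimately have tb: "snd (x (fst (t \<rho>), b)) = c" "snd (x (fst (t \<rho>), \<not> b)) = c" .
  let ?y = "prod.swap \<circ> x"
  have "linked I C R ?y"
  proof (rule linked_row_pair[OF terminals_swap[OF x] red])
    show "fst (t \<rho>) \<in> I" using t \<rho> by auto
    show "fst (?y (fst (t \<rho>), False)) = c" "fst (?y (fst (t \<rho>), True)) = c"
      using tb by (cases b; simp)+
    show "\<exists>\<gamma>\<in>C. (\<gamma>, r) \<notin> occupied I ?y" if "(c, r) \<in> occupied (I - {fst (t \<rho>)}) ?y" for r
    proof (rule ccontr)
      assume "\<not> ?thesis"
      \<comment> \<open>A full row and a full column together hold
        \<open>card R + card C - 1\<close> terminals, more than the \<open>2 * card I\<close>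
        available.\<close>
      then have "R \<times> {c} \<union> {r} \<times> C \<subseteq> occupied I x" using c by auto
      then have "card (R \<times> {c} \<union> {r} \<times> C) \<le> 2 * card I"
        using card_mono[of "occupied I x"] card_occupied[OF x] fin(1) by (auto simp: occupied_def)
      moreover from that have "(r, c) \<in> R \<times> C"
        unfolding occupied_swap by (metis DiffD1 occupiedE terminals_mem[OF x])
      then have "R \<times> {c} \<inter> {r} \<times> C = {(r, c)}" by auto
      then have "card (R \<times> {c} \<union> {r} \<times> C) + 1 = card R + card C"
        using card_Un_Int[of "R \<times> {c}" "{r} \<times> C"] fin by (simp add: card_cartesian_product)
      ultimately show False using fin by linarith
    qed
  qed
  then show ?thesis by (rule linked_swap)
qed

section \<open>Skew pairs and free corners\<close>

definition skew :: "'i set \<Rightarrow> ('i \<times> bool \<Rightarrow> 'a \<times> 'a) \<Rightarrow> bool" where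
  "skew I x \<longleftrightarrow> (\<forall>i\<in>I. \<forall>b. fst (x (i, b)) \<noteq> fst (x (i, \<not> b)) \<and> snd (x (i, b)) \<noteq> snd (x (i, \<not> b)))"

lemma skewD:
  assumes "skew I x" "i \<in> I"
  shows "fst (x (i, b)) \<noteq> fst (x (i, \<not> b))" "snd (x (i, b)) \<noteq> snd (x (i, \<not> b))"
  using assms unfolding skew_def by blast+

lemma skew_swap: "skew I x \<Longrightarrow> skew I (prod.swap \<circ> x)"
  by (simp add: skew_def)

lemma linked_if_not_skew:
  fixes x :: "'i \<times> bool \<Rightarrow> 'a \<times> 'a"
  assumes x: "terminals I R C x" and red: "subsets_linked I TYPE('a)" and "\<not> skew I x"
  shows "linked I R C x"
proof -
  obtain i b where i: "i \<in> I"
    "fst (x (i, b)) = fst (x (i, \<not> b)) \<or> snd (x (i, b)) = snd (x (i, \<not> b))"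
    using assms(3) unfolding skew_def by blast
  then have "fst (x (i, False)) = fst (x (i, True)) \<or> snd (x (i, False)) = snd (x (i, True))"
    by (cases b) auto
  then consider "fst (x (i, False)) = fst (x (i, True))" | "snd (x (i, False)) = snd (x (i, True))"
    by blast
  then show ?thesis
  proof cases
    case 1
    then show ?thesis using linked_aligned_row[OF x red] i by blast
  next
    case 2
    then show ?thesis
      using i by (intro linked_swap[OF linked_aligned_row[OF terminals_swap[OF x] red]]) auto
  qed
qed

text \<open>A skew pair has at most one terminal in any row, so \<open>fst\<close> is injective on
  these terminals.\<close>

lemma skew_card_row:
  assumes "skew I x" "J \<subseteq> I" "finite I"
  shows "card {\<tau>. fst \<tau> \<in> J \<and> fst (x \<tau>) = r} \<le> card J"
proof (rule card_inj_on_le[of fst])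
  show "inj_on fst {\<tau>. fst \<tau> \<in> J \<and> fst (x \<tau>) = r}"
  proof (rule inj_onI)
    fix \<tau> \<tau>' assume "\<tau> \<in> {\<tau>. fst \<tau> \<in> J \<and> fst (x \<tau>) = r}"
      "\<tau>' \<in> {\<tau>. fst \<tau> \<in> J \<and> fst (x \<tau>) = r}" "fst \<tau> = fst \<tau>'"
    then obtain i b b' where *: "i \<in> I" "\<tau> = (i, b)" "\<tau>' = (i, b')" "fst (x (i, b)) = fst (x (i, b'))"
      using assms(2) by (cases \<tau>; cases \<tau>') auto
    have False if "b' = (\<not> b)"
      using skewD(1)[OF assms(1) *(1), of b] *(4) unfolding that by simp
    then show "\<tau> = \<tau>'" using *(2,3) by auto
  qed
qed (use assms finite_subset in auto)

lemma skew_card_column: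
  assumes "skew I x" "J \<subseteq> I" "finite I"
  shows "card {\<tau>. fst \<tau> \<in> J \<and> snd (x \<tau>) = c} \<le> card J"
  using skew_card_row[OF skew_swap[OF assms(1)] assms(2,3)] by simp

text \<open>Off row \<open>r\<close>, the column of \<open>\<tau>\<close> has at least
  \<open>card I\<close> cells. Pair \<open>i\<close> occupies none of them, each other pair at most
  one, and the pair of \<open>\<tau>\<close> none, as \<open>\<tau>\<close> lies in row
  \<open>r\<close>; so at most \<open>card I - 2\<close> are occupied.\<close>

lemma card_free_column:
  assumes x: "terminals I R C x" and "skew I x" and i: "i \<in> I"
    and \<tau>: "fst \<tau> \<in> I - {i}" "fst (x \<tau>) = r"
    and pair: "\<And>b. fst (x (i, b)) \<noteq> r \<Longrightarrow> snd (x (i, b)) \<noteq> snd (x \<tau>)"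
  shows "2 \<le> card {z. fst z \<in> R - {r} \<and> snd z = snd (x \<tau>) \<and> z \<notin> occupied I x}"
proof -
  have fin: "finite I" "finite R" "card I < card R"
    using x by (auto simp: terminals_def)
  let ?A = "{\<tau>'. fst \<tau>' \<in> I - {i} \<and> snd (x \<tau>') = snd (x \<tau>)}"
  let ?L = "(R - {r}) \<times> {snd (x \<tau>)}"
  have r: "r \<in> R" using terminals_mem[OF x, of \<tau>] \<tau> by (auto simp: mem_Times_iff)
  have finA: "finite ?A"
    by (rule finite_subset[of _ "I \<times> UNIV"]) (use fin in auto)
  have sub: "?L \<inter> occupied I x \<subseteq> x ` (?A - {\<tau>})"
  proof
    fix z assume z: "z \<in> ?L \<inter> occupied I x"
    then obtain \<tau>' where t: "fst \<tau>' \<in> I" "x \<tau>' = z" by (meson IntD2 occupiedE)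
    have z': "fst z \<noteq> r" "snd z = snd (x \<tau>)" using z by (simp_all add: mem_Times_iff)
    have "x (fst \<tau>', snd \<tau>') = z" using t by simp
    then have "fst \<tau>' \<noteq> i" using pair[of "snd \<tau>'"] z' by metis
    moreover have "\<tau>' \<noteq> \<tau>" using t(2) \<tau>(2) z'(1) by metis
    ultimately have "\<tau>' \<in> ?A - {\<tau>}" using z'(2) t by simp
    then show "z \<in> x ` (?A - {\<tau>})" using t by blast
  qed
  have "\<tau> \<in> ?A" using \<tau>(1) by simp
  from card_Suc_Diff1[OF finA this] have 1: "card (?A - {\<tau>}) + 1 = card ?A"
    by linarith
  have 2: "card ?A \<le> card (I - {i})"
    by (rule skew_card_column[OF assms(2) Diff_subset fin(1)])
  have 3: "card (?L \<inter> occupied I x) \<le> card (?A - {\<tau>})"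
    using finA by (intro order_trans[OF card_mono[OF _ sub] card_image_le]) simp_all
  have 4: "card (I - {i}) + 1 = card I"
    using card_Suc_Diff1[OF fin(1) i] by linarith
  have 5: "card ?L + 1 = card R"
    using card_Suc_Diff1[OF fin(2) r] by (simp only: card_cartesian_product card.empty card.insert) simp
  have 6: "card (?L - occupied I x) = card ?L - card (?L \<inter> occupied I x)"
    using fin by (intro card_Diff_subset_Int) simp
  have "2 \<le> card (?L - occupied I x)" using 1 2 3 4 5 6 fin(3) by linarith
  also have "?L - occupied I x = {z. fst z \<in> R - {r} \<and> snd z = snd (x \<tau>) \<and> z \<notin> occupied I x}"
    by auto
  finally show ?thesis .
qed

lemma card_free_row:
  assumes x: "terminals I R C x" and sk: "skew I x" and i: "i \<in> I"
    and \<tau>: "fst \<tau> \<in> I - {i}" "snd (x \<tau>) = c"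
    and pair: "\<And>b. snd (x (i, b)) \<noteq> c \<Longrightarrow> fst (x (i, b)) \<noteq> fst (x \<tau>)"
  shows "2 \<le> card {z. snd z \<in> C - {c} \<and> fst z = fst (x \<tau>) \<and> z \<notin> occupied I x}"
proof -
  let ?y = "prod.swap \<circ> x"
  let ?S = "{z. fst z \<in> C - {c} \<and> snd z = snd (?y \<tau>) \<and> z \<notin> occupied I ?y}"
  have "2 \<le> card ?S"
    using pair \<tau> by (intro card_free_column[OF terminals_swap[OF x] skew_swap[OF sk] i]) auto
  also have "card ?S = card (prod.swap ` ?S)"
    by (simp add: card_image)
  also have "prod.swap ` ?S = {z. snd z \<in> C - {c} \<and> fst z = fst (x \<tau>) \<and> z \<notin> occupied I x}"
    by (auto simp: image_iff simp del: o_apply) auto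
  finally show ?thesis .
qed

lemma card_fibre:
  assumes "terminals I R C x"
  shows "card {\<tau>. fst \<tau> \<in> I \<and> x \<tau> = z} \<le> 1"
proof -
  have "\<tau> = \<tau>'" if "fst \<tau> \<in> I" "x \<tau> = z" "fst \<tau>' \<in> I" "x \<tau>' = z" for \<tau> \<tau>'
    using terminals_inj[OF assms, of \<tau> \<tau>'] that by simp
  then have "inj_on (\<lambda>_. ()) {\<tau>. fst \<tau> \<in> I \<and> x \<tau> = z}"
    by (intro inj_onI) blast
  then have "card {\<tau>. fst \<tau> \<in> I \<and> x \<tau> = z} \<le> card (UNIV :: unit set)"
    by (intro card_inj_on_le) auto
  then show ?thesis by simp
qed

text \<open>The pair is linked through its free corner \<open>(r, c)\<close>, and row
  \<open>r\<close> and column \<open>c\<close> are deleted. Each other terminal on these lines has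
  two free cells to escape to, perpendicular to its line, and
  \<open>distinct_representatives\<close> keeps the escapes apart.\<close>

lemma linked_free_corner:
  fixes x :: "'i \<times> bool \<Rightarrow> 'a \<times> 'a"
  assumes x: "terminals I R C x" and red: "subsets_linked I TYPE('a)" and sk: "skew I x"
    and i: "i \<in> I" and corner: "(fst (x (i, b)), snd (x (i, \<not> b))) \<notin> occupied I x"
  shows "linked I R C x"
proof -
  define r where "r = fst (x (i, b))"
  define c where "c = snd (x (i, \<not> b))"
  note T = x[unfolded terminals_def]
  note inj = terminals_inj[OF x] and xin = terminals_mem[OF x] and occ = occupiedI[where x = x]
  have rc: "(r, c) \<notin> occupied I x" using corner by (simp add: r_def c_def)
  have ib: "fst (x (i, \<not> b)) \<noteq> r" "snd (x (i, b)) \<noteq> c"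
    using skewD[OF sk i, of b] by (simp_all add: r_def c_def)
  have rR: "r \<in> R" and cC: "c \<in> C"
    using xin[of "(i, b)"] xin[of "(i, \<not> b)"] i by (simp_all add: r_def c_def mem_Times_iff)
  have split: "b' = b \<or> b' = (\<not> b)" for b' by auto
  define A where "A = {\<tau>. fst \<tau> \<in> I - {i} \<and> (fst (x \<tau>) = r \<or> snd (x \<tau>) = c)}"
  define F where "F \<tau> =
    (if fst (x \<tau>) = r then {z. fst z \<in> R - {r} \<and> snd z = snd (x \<tau>) \<and> z \<notin> occupied I x}
     else {z. snd z \<in> C - {c} \<and> fst z = fst (x \<tau>) \<and> z \<notin> occupied I x})" for \<tau>
  \<comment> \<open>The corner is free, so no terminal lies on both deleted lines.\<close>
  have nb: "snd (x \<tau>) \<noteq> c" if "fst (x \<tau>) = r" "fst \<tau> \<in> I" for \<tau>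
    using occ[of \<tau> I] rc that by (metis prod.collapse)
  have finA: "finite A"
    by (rule finite_subset[of _ "I \<times> UNIV"]) (use T in \<open>auto simp: A_def\<close>)
  have finF: "finite (F \<tau>)" if "\<tau> \<in> A" for \<tau>
    by (rule finite_subset[of _ "insert (fst (x \<tau>)) R \<times> insert (snd (x \<tau>)) C"])
      (use T in \<open>auto simp: F_def mem_Times_iff split: if_splits\<close>)
  have cardF: "2 \<le> card (F \<tau>)" if "\<tau> \<in> A" for \<tau>
  proof (cases "fst (x \<tau>) = r")
    case True
    \<comment> \<open>Off row \<open>r\<close>, pair \<open>i\<close> has only its terminal in
      column \<open>c\<close>, which \<open>\<tau>\<close> avoids.\<close>
    have "snd (x (i, b')) \<noteq> snd (x \<tau>)" if "fst (x (i, b')) \<noteq> r" for b'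
      using split[of b'] that nb[OF True] \<open>\<tau> \<in> A\<close> unfolding r_def c_def A_def by auto
    then show ?thesis
      using card_free_column[OF x sk i _ True] \<open>\<tau> \<in> A\<close> True by (auto simp: A_def F_def)
  next
    case False
    then have c: "snd (x \<tau>) = c" using that by (simp add: A_def)
    have "fst (x (i, b')) \<noteq> fst (x \<tau>)" if "snd (x (i, b')) \<noteq> c" for b'
      using split[of b'] that False unfolding r_def c_def by auto
    then show ?thesis
      using card_free_row[OF x sk i _ c] \<open>\<tau> \<in> A\<close> False by (auto simp: A_def F_def)
  qed
  have shared: "card {\<tau> \<in> A. z \<in> F \<tau>} \<le> 2" for z
  proof -
    let ?f = "\<lambda>w. {\<tau>. fst \<tau> \<in> I \<and> x \<tau> = w}"
    have fin: "finite (?f w)" for w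
      by (rule finite_subset[of _ "I \<times> UNIV"]) (use T in auto)
    \<comment> \<open>A cell can be wanted only by the terminal of row \<open>r\<close> in its
      column and by the terminal of column \<open>c\<close> in its row.\<close>
    have "{\<tau> \<in> A. z \<in> F \<tau>} \<subseteq> ?f (r, snd z) \<union> ?f (fst z, c)"
      by (auto simp: A_def F_def prod_eq_iff split: if_splits)
    then have "card {\<tau> \<in> A. z \<in> F \<tau>} \<le> card (?f (r, snd z) \<union> ?f (fst z, c))"
      using fin by (intro card_mono) auto
    also have "\<dots> \<le> 1 + 1"
      using card_fibre[OF x, of "(r, snd z)"] card_fibre[OF x, of "(fst z, c)"]
      by (intro order_trans[OF card_Un_le] add_mono)
    finally show ?thesis by simp
  qed
  obtain f where f: "inj_on f A" "\<And>\<tau>. \<tau> \<in> A \<Longrightarrow> f \<tau> \<in> F \<tau>"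
    using distinct_representatives[where F = F, OF finA finF cardF shared] by blast
  define y where "y \<tau> = (if \<tau> \<in> A then f \<tau> else x \<tau>)" for \<tau>
  have yA: "y \<tau> \<notin> occupied I x" "(x \<tau>, y \<tau>) \<in> aligned" "y \<tau> \<in> (R - {r}) \<times> (C - {c})"
    if "\<tau> \<in> A" for \<tau>
  proof -
    have a: "fst \<tau> \<in> I" "fst (x \<tau>) \<noteq> r \<Longrightarrow> snd (x \<tau>) = c" using that by (auto simp: A_def)
    have m: "fst (x \<tau>) \<in> R" "snd (x \<tau>) \<in> C" using xin[OF a(1)] by (auto simp: mem_Times_iff)
    have F: "y \<tau> \<in> F \<tau>" using f(2)[OF that] that by (simp add: y_def)
    show "y \<tau> \<notin> occupied I x" "(x \<tau>, y \<tau>) \<in> aligned" "y \<tau> \<in> (R - {r}) \<times> (C - {c})"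
      using F a m nb[of \<tau>] by (auto simp: F_def aligned_def mem_Times_iff split: if_splits)
  qed
  have yn: "y \<tau> = x \<tau>" if "\<tau> \<notin> A" for \<tau> using that by (simp add: y_def)
  have y_in: "y \<tau> \<in> (R - {r}) \<times> (C - {c})" if "fst \<tau> \<in> I - {i}" for \<tau>
  proof (cases "\<tau> \<in> A")
    case False
    then show ?thesis using xin[of \<tau>] that yn[OF False] by (auto simp: A_def mem_Times_iff)
  qed (use yA in simp)
  have inj_y: "\<tau> = \<tau>'" if m: "fst \<tau> \<in> I - {i}" "fst \<tau>' \<in> I - {i}" and e: "y \<tau> = y \<tau>'" for \<tau> \<tau>'
  proof -
    have "\<tau> \<in> A \<longleftrightarrow> \<tau>' \<in> A"
      using yA(1)[of \<tau>] yA(1)[of \<tau>'] yn[of \<tau>] yn[of \<tau>'] occ[of \<tau> I] occ[of \<tau>' I] e m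
      by (metis DiffD1)
    then show ?thesis
      using e f(1) inj[of \<tau> \<tau>'] m by (auto simp: y_def dest: inj_onD split: if_splits)
  qed
  have fin: "finite I" "finite R" "finite C" "card I < card R" "card I < card C"
    using T by auto
  have "terminals (I - {i}) (R - {r}) (C - {c}) y"
  proof (rule terminalsI)
    show "card (I - {i}) < card (R - {r})" "card (I - {i}) < card (C - {c})"
      using card_Suc_Diff1[OF fin(1) i] card_Suc_Diff1[OF fin(2) rR] card_Suc_Diff1[OF fin(3) cC] fin
      by linarith+
  qed (use fin inj_y y_in in blast)+
  then have "linked (I - {i}) (R - {r}) (C - {c}) y"
    using red i unfolding subsets_linked_def by blast
  then show ?thesis
  proof (rule linked_reduce[where J = "{i}" and V = "\<lambda>_. {x (i, b), (r, c), x (i, \<not> b)}", rotated -1])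
    show "x ` (I \<times> UNIV) \<subseteq> R \<times> C" "inj_on x (I \<times> UNIV)" using T by auto
    show "{x (i, b), (r, c), x (i, \<not> b)} \<subseteq> R \<times> C - (R - {r}) \<times> (C - {c})"
      using xin[of "(i, b)"] xin[of "(i, \<not> b)"] i rR cC by (simp add: r_def c_def mem_Times_iff)
    show "connected_in {x (i, b), (r, c), x (i, \<not> b)} (x (j, False)) (x (j, True))" if "j \<in> {i}" for j
    proof -
      have "connected_in {x (i, b), (r, c), x (i, \<not> b)} (x (i, b)) (x (i, \<not> b))"
        by (rule connected_in_three[of _ "(r, c)"]) (auto simp: aligned_def r_def c_def)
      then show ?thesis using that by (cases b) (auto intro: connected_in_sym)
    qed
    show "x (j, b') \<notin> {x (i, b), (r, c), x (i, \<not> b)}" if "j \<in> I - {i}" for j b'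
      using inj[of "(j, b')" "(i, b)"] inj[of "(j, b')" "(i, \<not> b)"] that i rc occ[of "(j, b')" I] by auto
    show "(x (j, b'), y (j, b')) \<in> aligned" for j b'
      using yA(2)[of "(j, b')"] yn[of "(j, b')"] by (cases "(j, b') \<in> A") (auto simp: aligned_def)
    show "y (j, b') = x (j, b')" if "x (j, b') \<in> (R - {r}) \<times> (C - {c})" for j b'
      using that by (intro yn) (auto simp: A_def mem_Times_iff)
  qed (use i in auto)
qed

section \<open>Configurations with all corners occupied\<close>

definition cornered :: "'i set \<Rightarrow> ('i \<times> bool \<Rightarrow> 'a \<times> 'a) \<Rightarrow> bool" where
  "cornered I x \<longleftrightarrow> (\<forall>i\<in>I. \<forall>b. (fst (x (i, b)), snd (x (i, \<not> b))) \<in> occupied I x)"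

lemma cornered_swap:
  assumes "cornered I x"
  shows "cornered I (prod.swap \<circ> x)"
  unfolding cornered_def
proof (intro ballI allI)
  fix i b assume "i \<in> I"
  then have "(fst (x (i, \<not> b)), snd (x (i, \<not> \<not> b))) \<in> occupied I x"
    using assms unfolding cornered_def by blast
  then show "(fst ((prod.swap \<circ> x) (i, b)), snd ((prod.swap \<circ> x) (i, \<not> b))) \<in> occupied I (prod.swap \<circ> x)"
    by simp
qed

lemma corneredE:
  assumes "cornered I x" "i \<in> I"
  obtains \<tau> where "fst \<tau> \<in> I" "fst (x \<tau>) = fst (x (i, b))" "snd (x \<tau>) = snd (x (i, \<not> b))"
proof -
  have "(fst (x (i, b)), snd (x (i, \<not> b))) \<in> occupied I x"
    using assms unfolding cornered_def by blast
  then show ?thesis by (rule occupiedE) (use that in simp)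
qed

text \<open>Columns are treated as rows of \<open>prod.swap \<circ> x\<close>.\<close>

definition row_terminals :: "'i set \<Rightarrow> ('i \<times> bool \<Rightarrow> 'a \<times> 'a) \<Rightarrow> 'a \<Rightarrow> ('i \<times> bool) set" where
  "row_terminals I x r = {\<tau>. fst \<tau> \<in> I \<and> fst (x \<tau>) = r}"

lemma finite_row_terminals: "finite I \<Longrightarrow> finite (row_terminals I x r)"
  by (rule finite_subset[of _ "I \<times> UNIV"]) (auto simp: row_terminals_def)

lemma rows_eq: "fst ` occupied I x = (fst \<circ> x) ` (I \<times> UNIV)"
  by (auto simp: occupied_def)

lemma rows_swap: "fst ` occupied I (prod.swap \<circ> x) = snd ` occupied I x"
  by (simp add: occupied_def image_image)

lemma sum_card_row:
  assumes "finite I"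
  shows "(\<Sum>r\<in>fst ` occupied I x. card (row_terminals I x r)) = 2 * card I"
proof -
  have "2 * card I = (\<Sum>\<tau>\<in>I \<times> (UNIV :: bool set). 1)"
    by (simp add: card_cartesian_product)
  also have "\<dots> = (\<Sum>r\<in>(fst \<circ> x) ` (I \<times> UNIV). \<Sum>\<tau> | \<tau> \<in> I \<times> UNIV \<and> (fst \<circ> x) \<tau> = r. 1)"
    using assms by (intro sum.image_gen) simp
  also have "\<dots> = (\<Sum>r\<in>fst ` occupied I x. card (row_terminals I x r))"
    unfolding rows_eq by (simp add: row_terminals_def mem_Times_iff)
  finally show ?thesis by simp
qed

text \<open>The corner in the row of a terminal holds a second terminal: it lies in the column of
  the partner, which by skewness is another column.\<close>

lemma card_row_ge_2:
  assumes "finite I" and sk: "skew I x" and co: "cornered I x" and r: "r \<in> fst ` occupied I x"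
  shows "2 \<le> card (row_terminals I x r)"
proof -
  obtain i b where i: "i \<in> I" "fst (x (i, b)) = r"
    using r by (auto simp: occupied_def)
  obtain \<tau> where \<tau>: "fst \<tau> \<in> I" "fst (x \<tau>) = fst (x (i, b))" "snd (x \<tau>) = snd (x (i, \<not> b))"
    by (rule corneredE[OF co i(1)])
  have "\<tau> \<noteq> (i, b)" using \<tau>(3) skewD(2)[OF sk i(1), of b] by metis
  then have "card {(i, b), \<tau>} = 2" by simp
  moreover have "{(i, b), \<tau>} \<subseteq> row_terminals I x r" using i \<tau> by (simp add: row_terminals_def)
  ultimately show ?thesis using card_mono[OF finite_row_terminals[OF assms(1)]] by metis
qed

text \<open>Double counting: there are \<open>2 * card I\<close> terminals, at least two in each
  occupied row. Hence a board with more rows than pairs has an empty row.\<close>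

lemma card_rows_le:
  assumes "finite I" "skew I x" "cornered I x"
  shows "card (fst ` occupied I x) \<le> card I"
proof -
  have "(\<Sum>r\<in>fst ` occupied I x. 2) \<le> (\<Sum>r\<in>fst ` occupied I x. card (row_terminals I x r))"
    using card_row_ge_2[OF assms] by (intro sum_mono)
  then show ?thesis using sum_card_row[OF assms(1), of x] by simp
qed

lemma rows_subset: "terminals I R C x \<Longrightarrow> fst ` occupied I x \<subseteq> R"
  by (auto simp: terminals_def occupied_def image_subset_iff mem_Times_iff)

text \<open>Since all corners are occupied, the pairs meeting a row \<open>r\<close> use only the columns that \<open>r\<close>
  meets. So deleting these columns and as many empty rows makes room for all these pairs.\<close>

lemma linked_row_group:
  fixes x :: "'i \<times> bool \<Rightarrow> 'a \<times> 'a"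
  assumes x: "terminals I R C x" and red: "subsets_linked I TYPE('a)" and sk: "skew I x"
    and co: "cornered I x" and r: "r \<in> fst ` occupied I x"
    and small: "card (row_terminals I x r) + card (fst ` occupied I x) \<le> card R"
  shows "linked I R C x"
proof -
  note T = x[unfolded terminals_def]
  note inj = terminals_inj[OF x] and xin = terminals_mem[OF x] and occ = occupiedI[where x = x]
  have fin: "finite I" "finite R" "finite C" "card I < card R" "card I < card C"
    using T by auto
  let ?rows = "fst ` occupied I x"
  \<comment> \<open>The pairs meeting row \<open>r\<close> and the columns it meets; there are
    equally many, one for each terminal of the row.\<close>
  define J where "J = fst ` row_terminals I x r"
  define D where "D = (snd \<circ> x) ` row_terminals I x r"
  have finrow: "finite (row_terminals I x r)" by (rule finite_row_terminals[OF fin(1)])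
  have JI: "J \<subseteq> I" by (auto simp: J_def row_terminals_def)
  have finJ: "finite J" "finite D" using finrow by (simp_all add: J_def D_def)
  have cardJ: "card J = card (row_terminals I x r)"
    unfolding J_def
  proof (rule card_image, rule inj_onI)
    fix \<tau> \<tau>' assume a: "\<tau> \<in> row_terminals I x r" "\<tau>' \<in> row_terminals I x r" "fst \<tau> = fst \<tau>'"
    have False if "snd \<tau> = (\<not> snd \<tau>')"
    proof -
      have "\<tau> = (fst \<tau>', \<not> snd \<tau>')" using a(3) that by (simp add: prod_eq_iff)
      then show False
        using skewD(1)[OF sk, of "fst \<tau>'" "snd \<tau>'"] a(1,2) by (simp add: row_terminals_def)
    qed
    then show "\<tau> = \<tau>'" using a(3) by (cases "snd \<tau>"; cases "snd \<tau>'") (simp_all add: prod_eq_iff)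
  qed
  have cardD: "card D = card (row_terminals I x r)"
    unfolding D_def
  proof (rule card_image, rule inj_onI)
    fix \<tau> \<tau>' assume a: "\<tau> \<in> row_terminals I x r" "\<tau>' \<in> row_terminals I x r" "(snd \<circ> x) \<tau> = (snd \<circ> x) \<tau>'"
    then have "x \<tau> = x \<tau>'" by (simp add: row_terminals_def prod_eq_iff)
    then show "\<tau> = \<tau>'" using inj[of \<tau> \<tau>'] a by (simp add: row_terminals_def)
  qed
  have rowsR: "?rows \<subseteq> R" by (rule rows_subset[OF x])
  have inrows: "fst (x \<tau>) \<in> ?rows" if "fst \<tau> \<in> I" for \<tau>
    using occ[of \<tau> I] that by blast
  have DC: "D \<subseteq> C" using xin by (auto simp: D_def row_terminals_def mem_Times_iff)
  \<comment> \<open>The partner of a terminal in row \<open>r\<close> shares its column with an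
    occupied corner in row \<open>r\<close>.\<close>
  have JD: "snd (x (j, b)) \<in> D" if "j \<in> J" for j b
  proof -
    obtain b0 where b0: "fst (x (j, b0)) = r"
      using \<open>j \<in> J\<close> by (auto simp: J_def row_terminals_def)
    have j: "j \<in> I" using that JI by auto
    show ?thesis
    proof (cases "b = b0")
      case True
      then have "(j, b) \<in> row_terminals I x r" using b0 j by (simp add: row_terminals_def)
      then show ?thesis by (auto simp: D_def)
    next
      case False
      then have b: "b = (\<not> b0)" by auto
      obtain \<tau> where \<tau>: "fst \<tau> \<in> I" "fst (x \<tau>) = fst (x (j, b0))" "snd (x \<tau>) = snd (x (j, \<not> b0))"
        by (rule corneredE[OF co j])
      then have "\<tau> \<in> row_terminals I x r" using b0 by (simp add: row_terminals_def)
      then show ?thesis unfolding b D_def by (rule rev_image_eqI) (simp add: \<tau>(3))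
    qed
  qed
  \<comment> \<open>By \<open>small\<close> there are enough empty rows to give each pair of
    \<open>J\<close> its own.\<close>
  have "card J \<le> card (R - ?rows)"
    using small cardJ rowsR fin(2) by (subst card_Diff_subset) (auto intro: finite_subset)
  then obtain g where g: "g ` J \<subseteq> R - ?rows" "inj_on g J"
    using card_le_inj[OF finJ(1), of "R - ?rows"] fin(2) by auto
  define R' where "R' = R - g ` J"
  define C' where "C' = C - D"
  have card_IJ: "card (I - J) + card J = card I"
    using JI fin(1) finJ(1) card_mono[OF fin(1) JI] by (simp add: card_Diff_subset)
  have "g ` J \<subseteq> R" using g(1) by blast
  then have card_R': "card R' + card J = card R"
    unfolding R'_def using fin(2) finJ(1) card_image[OF g(2)] card_mono[OF fin(2), of "g ` J"]
    by (simp add: card_Diff_subset)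
  have card_C': "card C' + card J = card C"
    unfolding C'_def using DC fin(3) finJ(2) cardD cardJ card_mono[OF fin(3) DC] by (simp add: card_Diff_subset)
  \<comment> \<open>The other terminals step inside their own rows off the columns \<open>D\<close>.
    Each row has at most \<open>card (I - J)\<close> of them, fewer than the remaining columns, so
    there is room even if those already off \<open>D\<close> stay.\<close>
  have "\<exists>h. inj_on h (row_terminals (I - J) x \<rho>) \<and> h ` row_terminals (I - J) x \<rho> \<subseteq> C' \<and>
      (\<forall>\<tau>\<in>row_terminals (I - J) x \<rho>. snd (x \<tau>) \<in> C' \<longrightarrow> h \<tau> = snd (x \<tau>))" for \<rho>
  proof -
    let ?A = "row_terminals (I - J) x \<rho>"
    have "card ?A \<le> card (I - J)"
      unfolding row_terminals_def by (rule skew_card_row[OF sk Diff_subset fin(1)])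
    then have "card ?A \<le> card C'" using card_IJ card_C' fin by linarith
    moreover have "inj_on (snd \<circ> x) {\<tau> \<in> ?A. snd (x \<tau>) \<in> C'}"
    proof (rule inj_onI)
      fix \<tau> \<tau>' assume "\<tau> \<in> {\<tau> \<in> ?A. snd (x \<tau>) \<in> C'}" "\<tau>' \<in> {\<tau> \<in> ?A. snd (x \<tau>) \<in> C'}"
        "(snd \<circ> x) \<tau> = (snd \<circ> x) \<tau>'"
      then show "\<tau> = \<tau>'" using inj[of \<tau> \<tau>'] by (simp add: row_terminals_def prod_eq_iff)
    qed
    moreover have "finite ?A" "finite C'" using fin by (auto simp: C'_def intro: finite_row_terminals)
    ultimately obtain h where "inj_on h ?A" "h ` ?A \<subseteq> C'"
      "\<And>\<tau>. \<tau> \<in> {\<tau> \<in> ?A. snd (x \<tau>) \<in> C'} \<Longrightarrow> h \<tau> = (snd \<circ> x) \<tau>"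
      using inj_on_extend[of ?A C' "{\<tau> \<in> ?A. snd (x \<tau>) \<in> C'}" "snd \<circ> x"] by auto
    then show ?thesis by (intro exI[of _ h]) simp
  qed
  then obtain h where h: "\<And>\<rho>. inj_on (h \<rho>) (row_terminals (I - J) x \<rho>)"
      "\<And>\<rho>. h \<rho> ` row_terminals (I - J) x \<rho> \<subseteq> C'"
      "\<And>\<rho> \<tau>. \<tau> \<in> row_terminals (I - J) x \<rho> \<Longrightarrow> snd (x \<tau>) \<in> C' \<Longrightarrow> h \<rho> \<tau> = snd (x \<tau>)"
    by metis
  define y where "y \<tau> = (fst (x \<tau>), h (fst (x \<tau>)) \<tau>)" for \<tau>
  have in_row: "\<tau> \<in> row_terminals (I - J) x (fst (x \<tau>))" if "fst \<tau> \<in> I - J" for \<tau>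
    using that by (simp add: row_terminals_def)
  have "terminals (I - J) R' C' y"
  proof (rule terminalsI)
    show "card (I - J) < card R'" "card (I - J) < card C'"
      using card_IJ card_R' card_C' fin by linarith+
    show "\<tau> = \<tau>'" if "fst \<tau> \<in> I - J" "fst \<tau>' \<in> I - J" "y \<tau> = y \<tau>'" for \<tau> \<tau>'
    proof -
      have e: "fst (x \<tau>) = fst (x \<tau>')" "h (fst (x \<tau>)) \<tau> = h (fst (x \<tau>')) \<tau>'"
        using that(3) unfolding y_def prod.inject by blast+
      show ?thesis
        by (rule inj_onD[OF h(1) e(2)[unfolded e(1)] in_row[OF that(1), unfolded e(1)] in_row[OF that(2)]])
    qed
    show "y \<tau> \<in> R' \<times> C'" if "fst \<tau> \<in> I - J" for \<tau>
    proof -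
      have "fst (x \<tau>) \<in> R'" using inrows[of \<tau>] that g(1) rowsR by (auto simp: R'_def)
      moreover have "h (fst (x \<tau>)) \<tau> \<in> C'" using h(2) in_row[OF that] by blast
      ultimately show ?thesis by (simp add: y_def)
    qed
  qed (use fin in \<open>simp_all add: R'_def C'_def\<close>)
  moreover have "I - J \<subset> I"
  proof -
    obtain i b where "i \<in> I" "fst (x (i, b)) = r" using r by (auto simp: occupied_def)
    then have "i \<in> J" unfolding J_def row_terminals_def by force
    then show ?thesis using \<open>i \<in> I\<close> by blast
  qed
  ultimately have linked: "linked (I - J) R' C' y"
    using red unfolding subsets_linked_def by blast
  \<comment> \<open>Each pair of \<open>J\<close> runs along its two columns to its empty row
    \<open>g j\<close>. All these cells have columns in \<open>D\<close>, so they are off the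
    smaller board.\<close>
  define V where "V j = {x (j, False), (g j, snd (x (j, False))), (g j, snd (x (j, True))), x (j, True)}" for j
  have gJ: "g j \<in> R" "g j \<notin> ?rows" if "j \<in> J" for j using g(1) that by auto
  show ?thesis
  proof (rule linked_reduce[where J = J and V = V, OF _ JI _ _ _ _ _ _ _ _ _ linked])
    show "x ` (I \<times> UNIV) \<subseteq> R \<times> C" "inj_on x (I \<times> UNIV)" using T by auto
    show "R' \<subseteq> R" "C' \<subseteq> C" by (auto simp: R'_def C'_def)
    show "V j \<subseteq> R \<times> C - R' \<times> C'" if j: "j \<in> J" for j
    proof
      fix z assume "z \<in> V j"
      then have "z \<in> R \<times> C" "snd z \<in> D"
        using xin[of "(j, _)"] JD[OF j] gJ[OF j] JI j DC by (auto simp: V_def)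
      then show "z \<in> R \<times> C - R' \<times> C'" by (auto simp: C'_def)
    qed
    show "connected_in (V j) (x (j, False)) (x (j, True))" if "j \<in> J" for j
      unfolding V_def
      by (rule connected_in_four[of _ "(g j, snd (x (j, False)))" "(g j, snd (x (j, True)))"])
        (simp_all add: aligned_def)
    show notV: "x (i, b) \<notin> V j" if "i \<in> I - J" "j \<in> J" for i b j
    proof -
      have "x (i, b) \<noteq> x (j, b')" for b'
        using inj[of "(i, b)" "(j, b')"] that JI by auto
      moreover have "fst (x (i, b)) \<noteq> g j"
        using gJ(2)[OF that(2)] inrows[of "(i, b)"] that(1) by (metis DiffD1 fst_conv)
      ultimately show ?thesis by (auto simp: V_def)
    qed
    have separate: "x (i, b) \<noteq> x (j, b')" "x (i, b) \<noteq> (g j, c)" "(g j, c) \<noteq> x (i, b)"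
      if "i \<in> J" "j \<in> J" "i \<noteq> j" for i j b b' c
    proof -
      have "fst (x (i, b)) \<noteq> g j"
        using gJ(2)[OF that(2)] inrows[of "(i, b)"] that(1) JI by (metis fst_conv subsetD)
      then show "x (i, b) \<noteq> (g j, c)" "(g j, c) \<noteq> x (i, b)" by (metis fst_conv)+
      show "x (i, b) \<noteq> x (j, b')" using inj[of "(i, b)" "(j, b')"] that JI by auto
    qed
    show "V i \<inter> V j = {}" if "i \<in> J" "j \<in> J" "i \<noteq> j" for i j
    proof -
      have "g i \<noteq> g j" using g(2) that by (auto dest: inj_onD)
      then show ?thesis
        using that that(3)[symmetric] by (auto simp: V_def separate)
    qed
    show "(x (i, b), y (i, b)) \<in> aligned" for i b by (simp add: y_def aligned_def)
    show "y (i, b) = x (i, b)" if "i \<in> I - J" "x (i, b) \<in> R' \<times> C'" for i b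
      using h(3)[OF in_row[of "(i, b)"]] that by (simp add: y_def mem_Times_iff prod_eq_iff)
  qed
qed

text \<open>No induction is involved: with at most two occupied rows, at least
  \<open>card I - 1\<close> rows are empty, one for each pair but \<open>i0\<close>. That pair uses
  an empty column, which exists since at most \<open>card I\<close> columns are occupied.\<close>

lemma linked_few_rows:
  fixes x :: "'i \<times> bool \<Rightarrow> 'a \<times> 'a"
  assumes x: "terminals I R C x" and sk: "skew I x" and co: "cornered I x"
    and few: "card (fst ` occupied I x) \<le> 2"
  shows "linked I R C x"
proof (cases "I = {}")
  case True
  then show ?thesis by (simp add: linked_def)
next
  case False
  then obtain i0 where i0: "i0 \<in> I" by auto
  note T = x[unfolded terminals_def]
  note inj = terminals_inj[OF x] and xin = terminals_mem[OF x] and occ = occupiedI[where x = x]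
  have fin: "finite I" "finite R" "finite C" "card I < card R" "card I < card C"
    using T by auto
  let ?rows = "fst ` occupied I x" and ?cols = "snd ` occupied I x"
  have rowsR: "?rows \<subseteq> R" by (rule rows_subset[OF x])
  have inrows: "fst (x \<tau>) \<in> ?rows" "snd (x \<tau>) \<in> ?cols" if "fst \<tau> \<in> I" for \<tau>
    using occ[of \<tau> I] that by blast+
  have "card ?cols \<le> card I"
    using card_rows_le[OF fin(1) skew_swap[OF sk] cornered_swap[OF co]] by (simp add: rows_swap)
  moreover have "finite ?cols" using fin by (simp add: occupied_def)
  ultimately have "\<not> C \<subseteq> ?cols" using fin(5) card_mono[of ?cols C] by linarith
  then obtain c0 where c0: "c0 \<in> C" "c0 \<notin> ?cols" by auto
  have "card (R - ?rows) = card R - card ?rows"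
    using rowsR fin(2) by (intro card_Diff_subset) (auto intro: finite_subset)
  then have "card (I - {i0}) \<le> card (R - ?rows)"
    using few fin(4) card_Suc_Diff1[OF fin(1) i0] by linarith
  then obtain g where g: "g ` (I - {i0}) \<subseteq> R - ?rows" "inj_on g (I - {i0})"
    using card_le_inj[of "I - {i0}" "R - ?rows"] fin by auto
  define W where "W j = (if j = i0 then {(fst (x (j, False)), c0), (fst (x (j, True)), c0)}
     else {(g j, snd (x (j, False))), (g j, snd (x (j, True)))})" for j
  define V where "V j = insert (x (j, False)) (insert (x (j, True)) (W j))" for j
  have gJ: "g j \<in> R" "g j \<notin> ?rows" if "j \<in> I" "j \<noteq> i0" for j using g(1) that by auto
  have xc: "fst (x (j, b)) \<in> R" "snd (x (j, b)) \<in> C" if "j \<in> I" for j b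
    using xin[of "(j, b)"] that by (auto simp: mem_Times_iff)
  have sub: "V j \<subseteq> R \<times> C" if "j \<in> I" for j
    using xc[OF that] gJ[of j] that c0(1) by (auto simp: V_def W_def mem_Times_iff)
  have con: "connected_in (V j) (x (j, False)) (x (j, True))" if "j \<in> I" for j
  proof (cases "j = i0")
    case True
    then show ?thesis
      by (intro connected_in_four[of _ "(fst (x (j, False)), c0)" "(fst (x (j, True)), c0)"])
        (simp_all add: aligned_def V_def W_def)
  next
    case False
    then show ?thesis
      by (intro connected_in_four[of _ "(g j, snd (x (j, False)))" "(g j, snd (x (j, True)))"])
        (simp_all add: aligned_def V_def W_def)
  qed
  have W: "z \<notin> occupied I x" if "z \<in> W j" "j \<in> I" for z j
  proof
    assume "z \<in> occupied I x"
    then have "fst z \<in> ?rows" "snd z \<in> ?cols" by blast+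
    moreover have "snd z = c0 \<or> j \<noteq> i0 \<and> fst z = g j"
      using that(1) by (auto simp: W_def split: if_splits)
    ultimately show False using c0(2) gJ(2)[OF that(2)] by metis
  qed
  have WW: "W i \<inter> W j = {}" if "i \<in> I" "j \<in> I" "i \<noteq> j" for i j
  proof -
    have "g i \<noteq> g j" if "i \<noteq> i0" "j \<noteq> i0"
      using g(2) that \<open>i \<in> I\<close> \<open>j \<in> I\<close> \<open>i \<noteq> j\<close> by (auto dest: inj_onD)
    moreover have "snd (x (i, b)) \<noteq> c0" "snd (x (j, b)) \<noteq> c0" for b
      using inrows(2)[of "(i, b)"] inrows(2)[of "(j, b)"] c0(2) that by auto
    ultimately show ?thesis using that by (auto simp: W_def)
  qed
  have dis: "V i \<inter> V j = {}" if "i \<in> I" "j \<in> I" "i \<noteq> j" for i j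
  proof -
    have "x (i, b) \<noteq> x (j, b')" for b b'
      using inj[of "(i, b)" "(j, b')"] that by auto
    moreover have "x (i, b) \<notin> W j" "x (j, b) \<notin> W i" for b
      using W[of "x (i, b)" j] W[of "x (j, b)" i] occ[of "(i, b)" I] occ[of "(j, b)" I] that by auto
    ultimately show ?thesis using WW[OF that] by (auto simp: V_def)
  qed
  show ?thesis unfolding linked_def using sub con dis by (intro exI[of _ V]) blast
qed

text \<open>When every row and column meeting a terminal contains exactly two, each pair forms a
  \<open>2 \<times> 2\<close> block together with the pair that occupies its two corners. One of the two pairs is
  linked through an empty column, the other through an empty row.\<close>

lemma linked_block:
  fixes x :: "'i \<times> bool \<Rightarrow> 'a \<times> 'a"
  assumes x: "terminals I R C x" and red: "subsets_linked I TYPE('a)" and sk: "skew I x"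
    and co: "cornered I x"
    and two: "\<And>r. r \<in> fst ` occupied I x \<Longrightarrow> card (row_terminals I x r) = 2"
             "\<And>c. c \<in> snd ` occupied I x \<Longrightarrow> card (row_terminals I (prod.swap \<circ> x) c) = 2"
  shows "linked I R C x"
proof (cases "I = {}")
  case True
  then show ?thesis by (simp add: linked_def)
next
  case False
  then obtain i where i: "i \<in> I" by auto
  note T = x[unfolded terminals_def]
  note inj = terminals_inj[OF x] and xin = terminals_mem[OF x] and occ = occupiedI[where x = x]
  have fin: "finite I" "finite R" "finite C" "card I < card R" "card I < card C"
    using T by auto
  let ?rows = "fst ` occupied I x" and ?cols = "snd ` occupied I x"
  have inrows: "fst (x \<tau>) \<in> ?rows" "snd (x \<tau>) \<in> ?cols" if "fst \<tau> \<in> I" for \<tau>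
    using occ[of \<tau> I] that by blast+
  have same_row: "\<tau>'' = \<tau> \<or> \<tau>'' = \<tau>'"
    if "fst \<tau> \<in> I" "fst \<tau>' \<in> I" "fst \<tau>'' \<in> I" "\<tau> \<noteq> \<tau>'"
      "fst (x \<tau>') = fst (x \<tau>)" "fst (x \<tau>'') = fst (x \<tau>)" for \<tau> \<tau>' \<tau>''
  proof -
    have "row_terminals I x (fst (x \<tau>)) = {\<tau>, \<tau>'}"
      using two(1)[OF inrows(1)[OF that(1)]] that
      by (intro card_subset_eq[symmetric] finite_row_terminals[OF fin(1)]) (auto simp: row_terminals_def)
    then show ?thesis using that by (auto simp: row_terminals_def)
  qed
  have same_col: "\<tau>'' = \<tau> \<or> \<tau>'' = \<tau>'"
    if "fst \<tau> \<in> I" "fst \<tau>' \<in> I" "fst \<tau>'' \<in> I" "\<tau> \<noteq> \<tau>'"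
      "snd (x \<tau>') = snd (x \<tau>)" "snd (x \<tau>'') = snd (x \<tau>)" for \<tau> \<tau>' \<tau>''
  proof -
    have "row_terminals I (prod.swap \<circ> x) (snd (x \<tau>)) = {\<tau>, \<tau>'}"
      using two(2)[OF inrows(2)[OF that(1)]] that
      by (intro card_subset_eq[symmetric] finite_row_terminals[OF fin(1)]) (auto simp: row_terminals_def)
    then show ?thesis using that by (auto simp: row_terminals_def)
  qed
  obtain r1 c1 r2 c2 where xi: "x (i, False) = (r1, c1)" "x (i, True) = (r2, c2)"
    by (metis prod.exhaust)
  have ne: "r1 \<noteq> r2" "c1 \<noteq> c2" using skewD[OF sk i, of False] xi by simp_all
  \<comment> \<open>The terminal in the corner \<open>(r1, c2)\<close> turns out to belong to
    another pair \<open>j\<close>.\<close>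
  obtain \<tau>1 where \<tau>1: "fst \<tau>1 \<in> I" "x \<tau>1 = (r1, c2)"
    using corneredE[OF co i, of False] xi by (metis fst_conv snd_conv prod.collapse)
  obtain j b where jb: "\<tau>1 = (j, b)" by (cases \<tau>1)
  have j: "j \<in> I" "x (j, b) = (r1, c2)" using \<tau>1 jb by auto
  have ji: "j \<noteq> i"
    using j(2) xi ne by (cases b) auto
  \<comment> \<open>The corner of \<open>j\<close> in row \<open>r1\<close> is occupied, and besides
    \<open>(j, b)\<close> only \<open>(i, False)\<close> lies in that row; so the partner of
    \<open>(j, b)\<close> is in column \<open>c1\<close>.\<close>
  have col: "snd (x (j, \<not> b)) = c1"
  proof -
    obtain \<tau> where \<tau>: "fst \<tau> \<in> I" "fst (x \<tau>) = fst (x (j, b))" "snd (x \<tau>) = snd (x (j, \<not> b))"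
      by (rule corneredE[OF co j(1)])
    have "\<tau> = (i, False) \<or> \<tau> = (j, b)"
      using \<tau> i j ji xi by (intro same_row) auto
    moreover have "\<tau> \<noteq> (j, b)" using skewD(2)[OF sk j(1), of b] \<tau>(3) by auto
    ultimately show ?thesis using \<tau>(3) xi by auto
  qed
  \<comment> \<open>The same argument in column \<open>c2\<close> places the partner in row
    \<open>r2\<close>.\<close>
  have row: "fst (x (j, \<not> b)) = r2"
  proof -
    obtain \<tau> where \<tau>: "fst \<tau> \<in> I" "fst (x \<tau>) = fst (x (j, \<not> b))" "snd (x \<tau>) = snd (x (j, \<not> \<not> b))"
      by (rule corneredE[OF co j(1)])
    have "\<tau> = (i, True) \<or> \<tau> = (j, b)"
      using \<tau> i j ji xi by (intro same_col) auto
    moreover have "\<tau> \<noteq> (j, b)" using skewD(1)[OF sk j(1), of b] \<tau>(2) by auto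
    ultimately show ?thesis using \<tau>(2) xi by auto
  qed
  have xj: "x (j, \<not> b) = (r2, c1)" using row col by (simp add: prod_eq_iff)
  have "card ?rows \<le> card I" "card ?cols \<le> card I"
    using card_rows_le[OF fin(1) sk co] card_rows_le[OF fin(1) skew_swap[OF sk] cornered_swap[OF co]]
    by (simp_all add: rows_swap)
  moreover have "finite ?rows" "finite ?cols" using fin by (simp_all add: occupied_def)
  ultimately have "\<not> R \<subseteq> ?rows" "\<not> C \<subseteq> ?cols"
    using fin card_mono[of ?rows R] card_mono[of ?cols C] by linarith+
  then obtain r0 c0 where 0: "r0 \<in> R" "r0 \<notin> ?rows" "c0 \<in> C" "c0 \<notin> ?cols" by auto
  have rc: "r1 \<in> R" "r2 \<in> R" "c1 \<in> C" "c2 \<in> C"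
    using xin[of "(i, False)"] xin[of "(i, True)"] i xi by auto
  have rc_rows: "r1 \<in> ?rows" "r2 \<in> ?rows" "c1 \<in> ?cols" "c2 \<in> ?cols"
    using inrows[of "(i, False)"] inrows[of "(i, True)"] i xi by auto
  have ne0: "r0 \<noteq> r1" "r0 \<noteq> r2" "c0 \<noteq> c1" "c0 \<noteq> c2" using 0 rc_rows by auto
  let ?R = "R - {r1, r2}" and ?C = "C - {c1, c2}" and ?J = "{i, j}"
  \<comment> \<open>The four lines of the block already hold their two terminals each, so no other
    terminal has to move.\<close>
  have x_in: "x \<tau> \<in> ?R \<times> ?C" if "fst \<tau> \<in> I - ?J" for \<tau>
  proof -
    have n: "\<tau> \<noteq> (i, b')" "\<tau> \<noteq> (j, b')" for b' using that by auto
    have I: "fst \<tau> \<in> I" using that by simp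
    have "fst (x \<tau>) \<noteq> r1" using same_row[of "(i, False)" "(j, b)" \<tau>] n I i j ji xi by auto
    moreover have "fst (x \<tau>) \<noteq> r2" using same_row[of "(i, True)" "(j, \<not> b)" \<tau>] n I i j ji xi row by auto
    moreover have "snd (x \<tau>) \<noteq> c1" using same_col[of "(i, False)" "(j, \<not> b)" \<tau>] n I i j ji xi col by auto
    moreover have "snd (x \<tau>) \<noteq> c2" using same_col[of "(i, True)" "(j, b)" \<tau>] n I i j ji xi by auto
    ultimately show ?thesis using xin[OF I] by (auto simp: mem_Times_iff)
  qed
  have "terminals (I - ?J) ?R ?C x"
  proof (rule terminalsI)
    have "card (I - ?J) + 2 = card I" "card ?R + 2 = card R" "card ?C + 2 = card C"
      using card_Diff_subset[of ?J I] card_Diff_subset[of "{r1, r2}" R] card_Diff_subset[of "{c1, c2}" C]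
        card_mono[of I ?J] card_mono[of R "{r1, r2}"] card_mono[of C "{c1, c2}"] ne ji i j rc fin
      by auto
    then show "card (I - ?J) < card ?R" "card (I - ?J) < card ?C" using fin by linarith+
  qed (use fin inj x_in in \<open>auto simp del: split_paired_All\<close>)
  then have linked: "linked (I - ?J) ?R ?C x"
    using red i unfolding subsets_linked_def by blast
  \<comment> \<open>Pair \<open>i\<close> uses the empty column \<open>c0\<close> inside the deleted
    rows, pair \<open>j\<close> the empty row \<open>r0\<close> inside the deleted columns.\<close>
  define V where "V l = (if l = i then {(r1, c1), (r1, c0), (r2, c0), (r2, c2)}
    else {(r1, c2), (r0, c2), (r0, c1), (r2, c1)})" for l
  show ?thesis
  proof (rule linked_reduce[where J = ?J and V = V, OF _ _ _ _ _ _ _ _ _ _ _ linked])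
    show "x ` (I \<times> UNIV) \<subseteq> R \<times> C" "inj_on x (I \<times> UNIV)" using T by auto
    show "?J \<subseteq> I" using i j by simp
    show "V l \<subseteq> R \<times> C - ?R \<times> ?C" for l
      using rc 0 by (auto simp: V_def)
    show "connected_in (V l) (x (l, False)) (x (l, True))" if "l \<in> ?J" for l
    proof (cases "l = i")
      case True
      then show ?thesis using xi
        by (intro connected_in_four[of _ "(r1, c0)" "(r2, c0)"]) (simp_all add: aligned_def V_def)
    next
      case False
      then have "connected_in (V l) (x (l, b)) (x (l, \<not> b))"
        using j(2) xj that
        by (intro connected_in_four[of _ "(r0, c2)" "(r0, c1)"]) (auto simp: aligned_def V_def)
      then show ?thesis by (cases b) (auto intro: connected_in_sym)
    qed
    show "V l \<inter> V l' = {}" if "l \<in> ?J" "l' \<in> ?J" "l \<noteq> l'" for l l'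
      using that ne ne0 ji by (auto simp: V_def)
    show "x (l, b') \<notin> V l'" if "l \<in> I - ?J" for l b' l'
    proof -
      have "x (l, b') \<in> ?R \<times> ?C" "fst (x (l, b')) \<in> ?rows"
        using x_in[of "(l, b')"] inrows[of "(l, b')"] that by auto
      then show ?thesis using 0 by (auto simp: V_def)
    qed
  qed (auto simp: aligned_def)
qed

text \<open>At most \<open>card I\<close> rows and at most \<open>card I\<close> columns are
  occupied. If one of these bounds is strict, \<open>linked_few_rows\<close> or
  \<open>linked_row_group\<close> applies, possibly after a swap. If both are attained, every line
  meeting a terminal holds exactly two, as \<open>linked_block\<close> requires.\<close>

lemma linked_if_cornered:
  fixes x :: "'i \<times> bool \<Rightarrow> 'a \<times> 'a"
  assumes x: "terminals I R C x" and red: "subsets_linked I TYPE('a)" and sk: "skew I x"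
    and co: "cornered I x"
  shows "linked I R C x"
proof -
  have few_rows: "linked I R C x"
    if x: "terminals I R C x" and sk: "skew I x" and co: "cornered I x"
      and p: "card (fst ` occupied I x) < card I" for R C and x :: "'i \<times> bool \<Rightarrow> 'a \<times> 'a"
  proof (cases "card (fst ` occupied I x) \<le> 2")
    case True
    then show ?thesis by (rule linked_few_rows[OF x sk co])
  next
    case False
    define p where "p = card (fst ` occupied I x)"
    have fin: "finite I" "card I < card R" using x by (auto simp: terminals_def)
    \<comment> \<open>Otherwise all \<open>p\<close> rows have at least \<open>k + 2 - p\<close> of the \<open>2 k\<close> terminals, and
      \<open>p (k + 2 - p) \<le> 2 k\<close> amounts to \<open>(p - 2) (k - p) \<le> 0\<close>.\<close>
    have "\<exists>r\<in>fst ` occupied I x. card (row_terminals I x r) + p \<le> card R"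
    proof (rule ccontr)
      assume "\<not> ?thesis"
      then have "card I + 2 - p \<le> card (row_terminals I x r)" if "r \<in> fst ` occupied I x" for r
        using that fin by fastforce
      then have "p * (card I + 2 - p) \<le> 2 * card I"
        using sum_mono[of "fst ` occupied I x" "\<lambda>_. card I + 2 - p" "\<lambda>r. card (row_terminals I x r)"]
        by (simp add: sum_card_row[OF fin(1)] p_def)
      \<comment> \<open>These offsets remove the truncated subtraction: the inequality becomes
        \<open>(m + 3) * (n + 3) \<le> 2 * (m + n + 4)\<close>.\<close>
      moreover obtain m n where "p = m + 3" "card I = p + 1 + n"
        using False that p by (metis add.commute less_imp_add_positive not_le_imp_less numeral_3_eq_3 p_def Suc_leI add_Suc_right le_Suc_ex Suc_eq_plus1 numeral_2_eq_2)
      ultimately show False by (simp add: algebra_simps)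
    qed
    then show ?thesis using linked_row_group[OF x red sk co] by (auto simp: p_def)
  qed
  have fin: "finite I" using x by (auto simp: terminals_def)
  have exact: "card (row_terminals I x r) = 2"
    if "skew I x" "cornered I x" "\<not> card (fst ` occupied I x) < card I" "r \<in> fst ` occupied I x"
    for r and x :: "'i \<times> bool \<Rightarrow> 'a \<times> 'a"
  proof (rule ccontr)
    assume ne: "card (row_terminals I x r) \<noteq> 2"
    have ge: "2 \<le> card (row_terminals I x s)" if "s \<in> fst ` occupied I x" for s
      by (rule card_row_ge_2[OF fin \<open>skew I x\<close> \<open>cornered I x\<close> that])
    have "(\<Sum>s\<in>fst ` occupied I x. 2) < (\<Sum>s\<in>fst ` occupied I x. card (row_terminals I x s))"
    proof (rule sum_strict_mono_ex1)
      show "\<exists>s\<in>fst ` occupied I x. 2 < card (row_terminals I x s)"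
        using ge[OF that(4)] ne that(4) by (intro bexI[of _ r]) linarith+
    qed (use fin ge in \<open>simp_all add: occupied_def\<close>)
    then show False using that(3) by (simp add: sum_card_row[OF fin])
  qed
  note x' = terminals_swap[OF x] and sk' = skew_swap[OF sk] and co' = cornered_swap[OF co]
  show ?thesis
  proof (cases "card (fst ` occupied I x) < card I \<or> card (snd ` occupied I x) < card I")
    case True
    then show ?thesis
      using few_rows[OF x sk co] linked_swap[OF few_rows[OF x' sk' co']] by (auto simp: rows_swap)
  next
    case False
    then show ?thesis
      using exact[OF sk co] exact[OF sk' co'] by (intro linked_block[OF x red sk co]) (simp_all add: rows_swap)
  qed
qed

lemma terminals_linked:
  fixes x :: "'i \<times> bool \<Rightarrow> 'a \<times> 'a"
  assumes "terminals I R C x"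
  shows "linked I R C x"
proof -
  have "finite I" using assms by (simp add: terminals_def)
  then show ?thesis using assms
  proof (induction I arbitrary: R C x rule: finite_psubset_induct)
    case (psubset I)
    then have red: "subsets_linked I TYPE('a)" by (simp add: subsets_linked_def)
    show ?case
    proof (cases "skew I x")
      case True
      then show ?thesis
        using linked_if_cornered[OF psubset.prems red True]
          linked_free_corner[OF psubset.prems red True] unfolding cornered_def by blast
    qed (rule linked_if_not_skew[OF psubset.prems red])
  qed
qed

subsection \<open>Duals of polytopes with \<open>d + 2\<close> vertices\<close>

text \<open>\<open>l\<close> spans the affine relations of the points, and \<open>m\<close>
  expresses the origin as a strictly positive convex combination. Together they control the slacks
  \<open>1 - v \<bullet> y\<close> of every point \<open>y\<close>.\<close>

locale simplicial_relation =
  fixes S :: "'a::euclidean_space set" and l m :: "'a \<Rightarrow> real"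
  assumes fin: "finite S" and card_S: "card S = DIM('a) + 2"
    and sum_l: "(\<Sum>v\<in>S. l v) = 0" and rel_l: "(\<Sum>v\<in>S. l v *\<^sub>R v) = 0"
    and l_nonzero: "v \<in> S \<Longrightarrow> l v \<noteq> 0"
    and sum_m: "(\<Sum>v\<in>S. m v) = 1" and rel_m: "(\<Sum>v\<in>S. m v *\<^sub>R v) = 0"
    and m_pos: "v \<in> S \<Longrightarrow> 0 < m v"
    and relation_unique:
      "(\<Sum>v\<in>S. u v) = 0 \<Longrightarrow> (\<Sum>v\<in>S. u v *\<^sub>R v) = 0 \<Longrightarrow> \<exists>x. \<forall>v\<in>S. u v = x * l v"
begin

text \<open>\<open>A\<close> and \<open>B\<close> are the two sides of the Radon partition of
  \<open>S\<close>.\<close>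

definition A where "A = {v \<in> S. 0 < l v}"
definition B where "B = {v \<in> S. l v < 0}"
text \<open>The dual of the hull of \<open>S\<close>, by
  \<open>dual_polytope_convex_hull\<close>.\<close>

definition Q where "Q = {y. \<forall>v\<in>S. v \<bullet> y \<le> 1}"

lemma AB: "a \<in> A \<Longrightarrow> b \<in> B \<Longrightarrow> a \<in> S \<and> b \<in> S \<and> a \<noteq> b"
  by (auto simp: A_def B_def)

section \<open>Vertices of the dual polytope\<close>

text \<open>A linear relation \<open>u\<close> with coefficient sum \<open>\<sigma>\<close> becomes
  an affine one after subtracting \<open>\<sigma> * m\<close>, hence equals \<open>k * l\<close>. At
  \<open>a\<close> and \<open>b\<close>, where \<open>u\<close> vanishes, \<open>l\<close> has
  opposite signs while \<open>m\<close> is positive; this forces \<open>k\<close> and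
  \<open>\<sigma>\<close> to be zero.\<close>

lemma independent_complement:
  assumes "a \<in> A" "b \<in> B"
  shows "independent (S - {a, b})"
proof (rule independent_if_scalars_zero)
  show "finite (S - {a, b})" using fin by simp
  fix f x assume f: "(\<Sum>v\<in>S - {a, b}. f v *\<^sub>R v) = 0" and x: "x \<in> S - {a, b}"
  define u where "u v = (if v \<in> {a, b} then 0 else f v)" for v
  define \<sigma> where "\<sigma> = (\<Sum>v\<in>S. u v)"
  have "(\<Sum>v\<in>S. u v *\<^sub>R v) = (\<Sum>v\<in>S - {a, b}. f v *\<^sub>R v)"
    by (rule sum.mono_neutral_cong_right) (use fin in \<open>auto simp: u_def\<close>)
  then have "(\<Sum>v\<in>S. (u v - \<sigma> * m v) *\<^sub>R v) = 0"
    using f rel_m by (simp add: scaleR_left_diff_distrib sum_subtractf flip: scaleR_scaleR scaleR_sum_right)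
  moreover have "(\<Sum>v\<in>S. u v - \<sigma> * m v) = 0"
    using sum_m by (simp add: sum_subtractf \<sigma>_def flip: sum_distrib_left)
  ultimately obtain k where k: "\<And>v. v \<in> S \<Longrightarrow> u v - \<sigma> * m v = k * l v"
    using relation_unique by blast
  have ab: "a \<in> S" "b \<in> S" "0 < l a" "l b < 0" using assms by (auto simp: A_def B_def)
  then have e: "- \<sigma> * m a = k * l a" "- \<sigma> * m b = k * l b"
    using k[of a] k[of b] by (auto simp: u_def)
  have "(k * l a) * (k * l b) = (\<sigma> * \<sigma>) * (m a * m b)" by (simp flip: e)
  moreover have "(k * l a) * (k * l b) = (k * k) * (l a * l b)" by simp
  moreover have "l a * l b < 0" using ab by (simp add: mult_pos_neg)
  moreover have "0 < m a * m b" using ab m_pos by simp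
  ultimately have "k * k \<le> 0"
    by (metis mult_less_0_iff mult_nonneg_nonneg less_imp_le not_le zero_le_square zero_less_mult_iff)
  then have "k = 0" by (auto simp: mult_le_0_iff)
  then have "\<sigma> = 0" using e(1) ab m_pos[of a] by simp
  then have "u x = 0" using k[of x] x \<open>k = 0\<close> by simp
  then show "f x = 0" using x by (simp add: u_def)
qed

lemma span_complement:
  assumes "a \<in> A" "b \<in> B"
  shows "span (S - {a, b}) = UNIV"
proof -
  have "card (S - {a, b}) = DIM('a)"
    using AB[OF assms] fin card_S by (simp add: card_Diff_subset)
  then have "UNIV \<subseteq> span (S - {a, b})"
    using independent_complement[OF assms] fin by (intro card_ge_dim_independent) auto
  then show ?thesis by auto
qed

lemma complement_unique:
  assumes "a \<in> A" "b \<in> B" "\<And>v. v \<in> S - {a, b} \<Longrightarrow> v \<bullet> y = v \<bullet> y'"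
  shows "y = y'"
proof -
  have "orthogonal (y - y') x" if "x \<in> S - {a, b}" for x
    using assms(3)[OF that] by (simp add: orthogonal_def inner_diff_left inner_commute[of y] inner_commute[of y'])
  then have "orthogonal (y - y') (y - y')"
    using orthogonal_to_span[of "y - y'" "S - {a, b}" "y - y'"] span_complement[OF assms(1,2)] by simp
  then show ?thesis by (simp add: orthogonal_self)
qed

lemma complement_exists:
  assumes "a \<in> A" "b \<in> B"
  shows "\<exists>y. \<forall>v\<in>S - {a, b}. v \<bullet> y = 1"
proof -
  obtain f :: "'a \<Rightarrow> real" where f: "linear f" "\<forall>v\<in>S - {a, b}. f v = 1"
    using linear_independent_extend[OF independent_complement[OF assms], of "\<lambda>_. 1"] by blast
  then have "v \<bullet> adjoint f 1 = 1" if "v \<in> S - {a, b}" for v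
    using adjoint_works[OF f(1), of v 1] that by simp
  then show ?thesis by blast
qed

text \<open>Well defined by \<open>complement_exists\<close> and \<open>complement_unique\<close>.
  It depends on the set \<open>{a, b}\<close> alone, which \<open>edge_vertex_right\<close>
  exploits.\<close>

definition vertex where
  "vertex a b = (SOME y. \<forall>v\<in>S - {a, b}. v \<bullet> y = 1)"

lemma inner_vertex: "a \<in> A \<Longrightarrow> b \<in> B \<Longrightarrow> v \<in> S - {a, b} \<Longrightarrow> v \<bullet> vertex a b = 1"
  using someI_ex[OF complement_exists] unfolding vertex_def by blast

text \<open>The slack is affine in \<open>v\<close>, and both vector sums vanish, so
  \<open>y\<close> drops out.\<close>

lemma slack_relations:
  "(\<Sum>v\<in>S. l v * (1 - v \<bullet> y)) = 0" "(\<Sum>v\<in>S. m v * (1 - v \<bullet> y)) = 1"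
proof -
  have "(\<Sum>v\<in>S. u v * (1 - v \<bullet> y)) = (\<Sum>v\<in>S. u v) - (\<Sum>v\<in>S. u v *\<^sub>R v) \<bullet> y" for u
    by (simp add: algebra_simps sum_subtractf inner_sum_left)
  then show "(\<Sum>v\<in>S. l v * (1 - v \<bullet> y)) = 0" "(\<Sum>v\<in>S. m v * (1 - v \<bullet> y)) = 1"
    using sum_l rel_l sum_m rel_m by simp_all
qed

lemma slack_two:
  assumes "a \<in> A" "b \<in> B" "\<And>v. v \<in> S - {a, b} \<Longrightarrow> v \<bullet> y = 1"
  shows "l a * (1 - a \<bullet> y) + l b * (1 - b \<bullet> y) = 0" "m a * (1 - a \<bullet> y) + m b * (1 - b \<bullet> y) = 1"
proof -
  have "(\<Sum>v\<in>S. u v * (1 - v \<bullet> y)) = (\<Sum>v\<in>{a, b}. u v * (1 - v \<bullet> y))" for u :: "'a \<Rightarrow> real"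
    using AB[OF assms(1,2)] fin assms(3) by (intro sum.mono_neutral_right) auto
  then show "l a * (1 - a \<bullet> y) + l b * (1 - b \<bullet> y) = 0" "m a * (1 - a \<bullet> y) + m b * (1 - b \<bullet> y) = 1"
    using slack_relations[of y] AB[OF assms(1,2)] by simp_all
qed

text \<open>Only two slacks can be nonzero. The relation \<open>l\<close>, with opposite signs at
  \<open>a\<close> and \<open>b\<close>, gives them the same sign, and their positive
  \<open>m\<close>-weighted sum 1 makes both positive.\<close>

lemma vertex_slack:
  assumes "a \<in> A" "b \<in> B"
  shows "a \<bullet> vertex a b < 1" "b \<bullet> vertex a b < 1"
proof -
  define p where "p = 1 - a \<bullet> vertex a b"
  define q where "q = 1 - b \<bullet> vertex a b"
  have pq: "l a * p + l b * q = 0" "m a * p + m b * q = 1"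
    using slack_two[OF assms inner_vertex[OF assms]] by (auto simp: p_def q_def)
  have s: "0 < l a" "l b < 0" "0 < m a" "0 < m b"
    using assms m_pos by (auto simp: A_def B_def)
  have q: "q = l a * p / (- l b)" using pq(1) s by (simp add: field_simps)
  have "0 < p"
  proof (rule ccontr)
    assume "\<not> 0 < p"
    then have "p \<le> 0" by simp
    then have "q \<le> 0" unfolding q using s by (intro divide_nonpos_pos) (auto simp: mult_le_0_iff)
    then have "m a * p + m b * q \<le> 0" using \<open>p \<le> 0\<close> s by (intro add_nonpos_nonpos mult_nonneg_nonpos) auto
    then show False using pq(2) by simp
  qed
  moreover from this have "0 < q" unfolding q using s by (intro divide_pos_pos) simp_all
  ultimately show "a \<bullet> vertex a b < 1" "b \<bullet> vertex a b < 1" by (simp_all add: p_def q_def)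
qed

lemma vertex_in_Q: "a \<in> A \<Longrightarrow> b \<in> B \<Longrightarrow> vertex a b \<in> Q"
  using inner_vertex vertex_slack unfolding Q_def
  by (smt (verit, best) DiffI empty_iff insert_iff mem_Collect_eq)

text \<open>Only \<open>a\<close> and \<open>b\<close> have positive slack at
  \<open>vertex a b\<close>, and the sign of \<open>l\<close> tells them apart.\<close>

lemma vertex_inj:
  assumes "a \<in> A" "b \<in> B" "a' \<in> A" "b' \<in> B" "vertex a b = vertex a' b'"
  shows "a = a'" "b = b'"
proof -
  have n: "a \<noteq> b'" "b \<noteq> a'" using assms by (auto simp: A_def B_def)
  show "a = a'"
    using inner_vertex[OF assms(3,4), of a] vertex_slack(1)[OF assms(1,2)] assms AB n by auto
  show "b = b'"
    using inner_vertex[OF assms(3,4), of b] vertex_slack(2)[OF assms(1,2)] assms AB n by auto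
qed

text \<open>A combination of nonnegative slacks with positive weights vanishes only if both slacks
  do.\<close>

lemma tight_open_segment:
  assumes "c \<in> Q" "d \<in> Q" "x \<in> open_segment c d" "v \<in> S" "v \<bullet> x = 1"
  shows "v \<bullet> c = 1" "v \<bullet> d = 1"
proof -
  obtain t where t: "0 < t" "t < 1" "x = (1 - t) *\<^sub>R c + t *\<^sub>R d"
    using assms(3) by (auto simp: in_segment)
  have le: "v \<bullet> c \<le> 1" "v \<bullet> d \<le> 1" using assms by (auto simp: Q_def)
  have e: "(1 - t) * (1 - v \<bullet> c) + t * (1 - v \<bullet> d) = 0"
    using assms(5) unfolding t(3) by (simp add: inner_add_right algebra_simps)
  have "0 \<le> (1 - t) * (1 - v \<bullet> c)" "0 \<le> t * (1 - v \<bullet> d)" using le t by simp_all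
  then have "(1 - t) * (1 - v \<bullet> c) = 0" "t * (1 - v \<bullet> d) = 0" using e by linarith+
  then show "v \<bullet> c = 1" "v \<bullet> d = 1" using t by simp_all
qed

lemma extreme_vertex:
  assumes "a \<in> A" "b \<in> B"
  shows "vertex a b extreme_point_of Q"
  unfolding extreme_point_of_def
proof (intro conjI ballI notI)
  show "vertex a b \<in> Q" by (rule vertex_in_Q[OF assms])
  fix c d assume cd: "c \<in> Q" "d \<in> Q" "vertex a b \<in> open_segment c d"
  have "v \<bullet> c = v \<bullet> d" if "v \<in> S - {a, b}" for v
    using tight_open_segment[OF cd, of v] inner_vertex[OF assms that] that by simp
  then have "c = d" by (rule complement_unique[OF assms])
  then show False using cd(3) by simp
qed

text \<open>The points with positive slack, \<open>L\<close>, include one from \<open>A\<close> and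
  one from \<open>B\<close> because the \<open>l\<close>-weighted slacks cancel. With a third such
  point, too few inequalities would be tight and \<open>y\<close> could be moved both ways along a
  line in \<open>Q\<close>.\<close>

lemma extreme_point_vertex:
  assumes "y extreme_point_of Q"
  shows "\<exists>a\<in>A. \<exists>b\<in>B. y = vertex a b"
proof -
  have y: "\<And>v. v \<in> S \<Longrightarrow> v \<bullet> y \<le> 1" using assms by (auto simp: extreme_point_of_def Q_def)
  define L where "L = {v \<in> S. v \<bullet> y < 1}"
  have L: "L \<subseteq> S" "finite L" using fin by (auto simp: L_def)
  have slack: "v \<in> S \<Longrightarrow> 0 \<le> 1 - v \<bullet> y" for v using y by simp
  have "\<exists>v\<in>S. v \<bullet> y \<noteq> 1"
    using slack_relations(2)[of y] by (metis (no_types, lifting) diff_self mult_zero_right sum.neutral zero_neq_one)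
  then obtain v0 where v0: "v0 \<in> L" using y by (force simp: L_def)
  \<comment> \<open>Otherwise a vanishing sum of nonnegative terms would make all slacks zero;
    \<open>s\<close> covers both signs of \<open>l\<close>.\<close>
  have sign: "\<exists>v\<in>L. 0 < s * l v" if "s = 1 \<or> s = - 1" for s
  proof (rule ccontr)
    assume n: "\<not> ?thesis"
    have ge: "0 \<le> - (s * l v) * (1 - v \<bullet> y)" if "v \<in> S" for v
    proof (cases "v \<in> L")
      case True
      then have "0 \<le> - (s * l v)" using n by force
      then show ?thesis using slack[OF that] by (rule mult_nonneg_nonneg)
    qed (use y[OF that] that in \<open>auto simp: L_def\<close>)
    have "(\<Sum>v\<in>S. - (s * l v) * (1 - v \<bullet> y)) = - s * (\<Sum>v\<in>S. l v * (1 - v \<bullet> y))"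
      unfolding sum_distrib_left by (intro sum.cong) (simp_all add: algebra_simps)
    then have "(\<Sum>v\<in>S. - (s * l v) * (1 - v \<bullet> y)) = 0"
      using slack_relations(1)[of y] by simp
    then have "\<forall>v\<in>S. - (s * l v) * (1 - v \<bullet> y) = 0"
      using ge by (subst (asm) sum_nonneg_eq_0_iff[OF fin]) auto
    then have "s * l v0 * (1 - v0 \<bullet> y) = 0" using v0 L(1) by auto
    then show False using that l_nonzero[of v0] v0 by (auto simp: L_def)
  qed
  obtain a b where ab: "a \<in> L" "0 < l a" "b \<in> L" "l b < 0"
    using sign[of 1] sign[of "- 1"] by auto
  then have AB': "a \<in> A" "b \<in> B" "a \<noteq> b" using L by (auto simp: A_def B_def)
  have "L = {a, b}"
  proof (rule ccontr)
    assume "L \<noteq> {a, b}"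
    then have "{a, b} \<subset> L" using ab by blast
    from psubset_card_mono[OF L(2) this] have "2 < card L" using AB'(3) by simp
    moreover have "card (S - L) + card L = DIM('a) + 2"
      using card_Diff_subset[OF L(2,1)] card_mono[OF fin L(1)] card_S by linarith
    ultimately have "card (S - L) < DIM('a)" by linarith
    then have "dim (S - L) < DIM('a)"
      using dim_le_card'[of "S - L"] fin by simp
    \<comment> \<open>Fewer than \<open>DIM('a)\<close> inequalities are tight, so some direction
      keeps all of them tight.\<close>
    then obtain w where w: "w \<noteq> 0" "\<And>v. v \<in> span (S - L) \<Longrightarrow> orthogonal w v"
      by (rule orthogonal_to_subspace_exists) blast
    \<comment> \<open>Moving by \<open>\<delta> / M\<close> along \<open>w\<close> uses up at most
      the smallest slack \<open>\<delta>\<close>; the \<open>+ 1\<close> makes \<open>M\<close>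
      positive.\<close>
    define M where "M = Max ((\<lambda>v. \<bar>v \<bullet> w\<bar>) ` S) + 1"
    define \<delta> where "\<delta> = Min ((\<lambda>v. 1 - v \<bullet> y) ` L)"
    have \<delta>: "0 < \<delta>" "\<And>v. v \<in> L \<Longrightarrow> \<delta> \<le> 1 - v \<bullet> y"
    proof -
      have "finite ((\<lambda>v. 1 - v \<bullet> y) ` L)" "(\<lambda>v. 1 - v \<bullet> y) ` L \<noteq> {}" using L(2) v0 by auto
      then show "0 < \<delta>" "\<And>v. v \<in> L \<Longrightarrow> \<delta> \<le> 1 - v \<bullet> y"
        unfolding \<delta>_def by (auto simp: L_def)
    qed
    have M: "\<bar>v \<bullet> w\<bar> \<le> M" "0 < M" if "v \<in> S" for v
    proof -
      have *: "\<bar>v \<bullet> w\<bar> \<le> Max ((\<lambda>v. \<bar>v \<bullet> w\<bar>) ` S)" using fin that by (intro Max_ge) auto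
      then show "\<bar>v \<bullet> w\<bar> \<le> M" "0 < M" by (simp_all add: M_def)
    qed
    have Mp: "0 < M" using M(2) v0 L(1) by blast
    define \<epsilon> where "\<epsilon> = \<delta> / M"
    have \<epsilon>: "0 < \<epsilon>" using \<delta>(1) Mp by (simp add: \<epsilon>_def)
    have "y + (s * \<epsilon>) *\<^sub>R w \<in> Q" if s: "\<bar>s\<bar> = 1" for s
      unfolding Q_def
    proof (intro CollectI ballI)
      fix v assume v: "v \<in> S"
      show "v \<bullet> (y + (s * \<epsilon>) *\<^sub>R w) \<le> 1"
      proof (cases "v \<in> L")
        case True
        have "s * \<epsilon> * (v \<bullet> w) \<le> \<bar>s * \<epsilon> * (v \<bullet> w)\<bar>" by simp
        also have "\<dots> = \<epsilon> * \<bar>v \<bullet> w\<bar>" using s \<epsilon> by (simp add: abs_mult)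
        also have "\<dots> \<le> \<epsilon> * M" using M(1)[OF v] \<epsilon> by (intro mult_left_mono) auto
        also have "\<dots> = \<delta>" using Mp by (simp add: \<epsilon>_def)
        finally show ?thesis using \<delta>(2)[OF True] by (simp add: inner_add_right)
      next
        case False
        then have "v \<bullet> w = 0"
          using w(2)[of v] v by (simp add: span_base orthogonal_def inner_commute)
        then show ?thesis using y[OF v] by (simp add: inner_add_right)
      qed
    qed
    from this[of 1] this[of "- 1"] have "y + \<epsilon> *\<^sub>R w \<in> Q" "y - \<epsilon> *\<^sub>R w \<in> Q" by simp_all
    moreover have "y \<in> open_segment (y + \<epsilon> *\<^sub>R w) (y - \<epsilon> *\<^sub>R w)"
      unfolding in_segment using w(1) \<epsilon>
      by (auto intro!: exI[of _ "1/2"] simp: algebra_simps simp flip: scaleR_add_left)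
    ultimately show False using assms unfolding extreme_point_of_def by blast
  qed
  then have "v \<bullet> y = 1" if "v \<in> S - {a, b}" for v
    using y[of v] that by (force simp: L_def)
  then have "y = vertex a b"
    using inner_vertex[OF AB'(1,2)] by (intro complement_unique[OF AB'(1,2)]) simp
  then show ?thesis using AB' by blast
qed

section \<open>Edges of the dual polytope\<close>

lemma convex_Q: "convex Q"
proof -
  have "Q = (\<Inter>v\<in>S. {y. v \<bullet> y \<le> 1})" by (auto simp: Q_def)
  then show ?thesis by (auto intro: convex_INT convex_halfspace_le)
qed

text \<open>The points of \<open>Q\<close> where given inequalities are tight form a face, by
  \<open>tight_open_segment\<close>. The segment lies in this face, so \<open>F\<close> makes them
  equal, and distinct endpoints give dimension 1.\<close>

lemma edge_vertex_aux:
  assumes ab: "a \<in> A" "b \<in> B" "a' \<in> A" "b' \<in> B" and ne: "vertex a b \<noteq> vertex a' b'"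
    and F: "{y \<in> Q. \<forall>v\<in>S - {a, b, a', b'}. v \<bullet> y = 1} \<subseteq> closed_segment (vertex a b) (vertex a' b')"
  shows "closed_segment (vertex a b) (vertex a' b') edge_of Q"
proof -
  let ?F = "{y \<in> Q. \<forall>v\<in>S - {a, b, a', b'}. v \<bullet> y = 1}"
  let ?s = "closed_segment (vertex a b) (vertex a' b')"
  have "v \<bullet> y = 1" if "y \<in> ?s" "v \<in> S - {a, b, a', b'}" for v y
    using that inner_vertex[OF ab(1,2), of v] inner_vertex[OF ab(3,4), of v]
    by (auto simp: in_segment inner_add_right)
  moreover have "?s \<subseteq> Q"
    using vertex_in_Q ab by (intro closed_segment_subset convex_Q) auto
  ultimately have eq: "?s = ?F" using F by blast
  have "?F face_of Q"
    unfolding face_of_def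
  proof (intro conjI ballI impI)
    show "convex ?F" using eq convex_closed_segment by metis
    fix c d x assume *: "c \<in> Q" "d \<in> Q" "x \<in> ?F" "x \<in> open_segment c d"
    then show "c \<in> ?F" "d \<in> ?F"
      using tight_open_segment[OF *(1,2,4)] by auto
  qed auto
  moreover have "aff_dim ?s = 1"
    using ne aff_dim_2[of "vertex a b" "vertex a' b'"] by (simp add: segment_convex_hull aff_dim_convex_hull)
  ultimately show ?thesis using eq unfolding edge_of_def by metis
qed

text \<open>A point of this face can have slack only at \<open>a\<close>, \<open>b\<close> and
  \<open>b'\<close>. Its slacks are a convex combination of those of the two vertices, and as slacks
  determine a point, it is the same combination of the vertices.\<close>

lemma edge_vertex_left:
  assumes ab: "a \<in> A" "b \<in> B" "b' \<in> B" "b \<noteq> b'"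
  shows "closed_segment (vertex a b) (vertex a b') edge_of Q"
proof (rule edge_vertex_aux[OF ab(1,2) ab(1,3)])
  show "vertex a b \<noteq> vertex a b'" using vertex_inj(2)[OF ab(1,2) ab(1,3)] ab(4) by blast
  show "{y \<in> Q. \<forall>v\<in>S - {a, b, a, b'}. v \<bullet> y = 1} \<subseteq> closed_segment (vertex a b) (vertex a b')"
  proof
    fix y assume y: "y \<in> {y \<in> Q. \<forall>v\<in>S - {a, b, a, b'}. v \<bullet> y = 1}"
    have S: "a \<in> S" "b \<in> S" "b' \<in> S" "a \<noteq> b" "a \<noteq> b'" using AB ab by auto
    have pos: "0 < l a" "0 < m a" "0 < m b" "0 < m b'"
      using ab m_pos S by (auto simp: A_def)
    \<comment> \<open>The slack of \<open>vertex a b\<close> vanishes at \<open>b'\<close> and that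
      of \<open>vertex a b'\<close> at \<open>b\<close>, so the coefficients are read off at these
      two points.\<close>
    define \<theta> where "\<theta> = (1 - b \<bullet> y) / (1 - b \<bullet> vertex a b)"
    define \<eta> where "\<eta> = (1 - b' \<bullet> y) / (1 - b' \<bullet> vertex a b')"
    have d: "0 < 1 - b \<bullet> vertex a b" "0 < 1 - b' \<bullet> vertex a b'"
      using vertex_slack(2) ab by simp_all
    have nonneg: "0 \<le> \<theta>" "0 \<le> \<eta>"
      using y S d by (auto simp: \<theta>_def \<eta>_def Q_def)
    define z where "z v = 1 - v \<bullet> y" for v
    define p where "p v = 1 - v \<bullet> vertex a b" for v
    define q where "q v = 1 - v \<bullet> vertex a b'" for v
    have zero: "z v = 0" "p v = 0" "q v = 0" if "v \<in> S - {a, b, b'}" for v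
      using y that inner_vertex[OF ab(1,2), of v] inner_vertex[OF ab(1,3), of v]
      by (auto simp: z_def p_def q_def)
    have pq0: "p b' = 0" "q b = 0"
      using inner_vertex[OF ab(1,2), of b'] inner_vertex[OF ab(1,3), of b] S ab(4)
      by (auto simp: p_def q_def)
    have b: "z b = \<theta> * p b + \<eta> * q b" "z b' = \<theta> * p b' + \<eta> * q b'"
      using d pq0 by (auto simp: \<theta>_def \<eta>_def z_def p_def q_def)
    have three: "u a * f a + u b * f b + u b' * f b' = (\<Sum>v\<in>S. u v * f v)"
      if "\<And>v. v \<in> S - {a, b, b'} \<Longrightarrow> f v = 0" for u f :: "'a \<Rightarrow> real"
    proof -
      have "(\<Sum>v\<in>S. u v * f v) = (\<Sum>v\<in>{a, b, b'}. u v * f v)"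
        using S fin that by (intro sum.mono_neutral_right) auto
      then show ?thesis using S ab(4) by simp
    qed
    have lz: "l a * z a + l b * z b + l b' * z b' = 0"
      using three[of z l] zero slack_relations(1)[of y] by (simp add: z_def)
    have lp: "l a * p a + l b * p b + l b' * p b' = 0"
      using three[of p l] zero slack_relations(1)[of "vertex a b"] by (simp add: p_def)
    have lq: "l a * q a + l b * q b + l b' * q b' = 0"
      using three[of q l] zero slack_relations(1)[of "vertex a b'"] by (simp add: q_def)
    \<comment> \<open>The relation \<open>l\<close> determines the slack at \<open>a\<close> from
      those at \<open>b\<close> and \<open>b'\<close>, since \<open>l a\<close> is nonzero.\<close>
    have "l a * z a = l a * (\<theta> * p a + \<eta> * q a)"
      using lz lp lq unfolding b by algebra
    then have a: "z a = \<theta> * p a + \<eta> * q a" using pos by simp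
    have z: "z v = \<theta> * p v + \<eta> * q v" if "v \<in> S" for v
      using a b zero[of v] that by (cases "v \<in> {a, b, b'}") auto
    \<comment> \<open>Every slack function has \<open>m\<close>-weighted sum 1, so the coefficients
      add up to 1.\<close>
    have "1 = (\<Sum>v\<in>S. m v * z v)" using slack_relations(2)[of y] by (simp add: z_def)
    also have "\<dots> = (\<Sum>v\<in>S. \<theta> * (m v * p v) + \<eta> * (m v * q v))"
      by (intro sum.cong) (auto simp: z algebra_simps)
    also have "\<dots> = \<theta> + \<eta>"
      using slack_relations(2)[of "vertex a b"] slack_relations(2)[of "vertex a b'"]
      by (simp add: sum.distrib p_def q_def flip: sum_distrib_left)
    finally have one: "\<theta> = 1 - \<eta>" by simp
    have "v \<bullet> y = v \<bullet> ((1 - \<eta>) *\<^sub>R vertex a b + \<eta> *\<^sub>R vertex a b')" if "v \<in> S" for v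
      using z[OF that] unfolding one z_def p_def q_def by (simp add: inner_add_right algebra_simps)
    then have "y = (1 - \<eta>) *\<^sub>R vertex a b + \<eta> *\<^sub>R vertex a b'"
      by (intro complement_unique[OF ab(1,2)]) simp
    then show "y \<in> closed_segment (vertex a b) (vertex a b')"
      using nonneg one by (auto simp: in_segment)
  qed
qed


text \<open>Negating \<open>l\<close> swaps \<open>A\<close> and \<open>B\<close> and leaves
  \<open>Q\<close> and the vertices unchanged.\<close>

lemma edge_vertex_right:
  assumes ab: "a \<in> A" "b \<in> B" "a' \<in> A" "a \<noteq> a'"
  shows "closed_segment (vertex a b) (vertex a' b) edge_of Q"
proof -
  interpret neg: simplicial_relation S "\<lambda>v. - l v" m
  proof
    show "\<exists>x. \<forall>v\<in>S. u v = x * - l v" if "sum u S = 0" "(\<Sum>v\<in>S. u v *\<^sub>R v) = 0" for u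
    proof -
      from relation_unique[OF that] obtain x where "\<forall>v\<in>S. u v = x * l v" by blast
      then show ?thesis by (intro exI[of _ "- x"]) simp
    qed
  qed (use fin card_S sum_l rel_l l_nonzero sum_m rel_m m_pos in \<open>simp_all add: sum_negf\<close>)
  have "neg.A = B" "neg.B = A" by (auto simp: A_def B_def neg.A_def neg.B_def)
  moreover have "neg.vertex b a = vertex a b" for a b
    by (simp add: vertex_def neg.vertex_def insert_commute)
  moreover have "neg.Q = Q" by (simp add: Q_def neg.Q_def)
  ultimately show ?thesis using neg.edge_vertex_left[of b a a'] ab by simp
qed

end

subsection \<open>Relations between points on the moment curve\<close>

text \<open>The coordinates of the curve and the coefficient sum make \<open>u\<close> annihilate
  \<open>1, t, ..., t ^ CARD('n)\<close>.\<close>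

lemma relation_moment_curve_poly:
  fixes e :: "'n::finite \<Rightarrow> nat" and u :: "real \<Rightarrow> real"
  assumes e: "bij_betw e UNIV {1..CARD('n)}"
    and u: "(\<Sum>t\<in>T. u t) = 0" "(\<Sum>t\<in>T. u t *\<^sub>R moment_curve e t) = 0"
    and p: "degree p \<le> CARD('n)"
  shows "(\<Sum>t\<in>T. u t * poly p t) = 0"
proof -
  have pow: "(\<Sum>t\<in>T. u t * t ^ j) = 0" if "j \<le> CARD('n)" for j
  proof (cases "j = 0")
    case True
    then show ?thesis using u(1) by simp
  next
    case False
    then have "j \<in> e ` UNIV" using that e by (auto simp: bij_betw_def)
    then obtain i where "j = e i" by blast
    moreover have "(\<Sum>t\<in>T. u t *\<^sub>R moment_curve e t) $ i = 0" using u(2) by simp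
    ultimately show ?thesis by (simp add: moment_curve_def)
  qed
  have "(\<Sum>t\<in>T. u t * poly p t) = (\<Sum>t\<in>T. \<Sum>j\<le>degree p. coeff p j * (u t * t ^ j))"
    by (simp add: poly_altdef sum_distrib_left mult.left_commute)
  also have "\<dots> = (\<Sum>j\<le>degree p. coeff p j * (\<Sum>t\<in>T. u t * t ^ j))"
    by (subst sum.swap) (simp add: sum_distrib_left)
  also have "\<dots> = 0"
    using pow p by (intro sum.neutral) simp
  finally show ?thesis .
qed

text \<open>The relation is tested on the polynomial vanishing at all nodes but \<open>t0\<close>
  and \<open>t\<close>. Its degree is at most \<open>CARD('n)\<close>, and only the term of
  \<open>t\<close> survives.\<close>

lemma relation_moment_curve_zero:
  fixes e :: "'n::finite \<Rightarrow> nat" and u :: "real \<Rightarrow> real"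
  assumes e: "bij_betw e UNIV {1..CARD('n)}"
    and u: "(\<Sum>t\<in>T. u t) = 0" "(\<Sum>t\<in>T. u t *\<^sub>R moment_curve e t) = 0"
    and T: "finite T" "card T \<le> CARD('n) + 2"
    and t0: "t0 \<in> T" "u t0 = 0" and t: "t \<in> T"
  shows "u t = 0"
proof (cases "t = t0")
  case False
  define p :: "real poly" where "p = (\<Prod>s\<in>T - {t0, t}. [:- s, 1:])"
  have "card (T - {t0, t}) \<le> CARD('n)"
    using T t0 t False by (simp add: card_Diff_subset)
  moreover have "degree p \<le> card (T - {t0, t})"
    using degree_prod_sum_le[of "T - {t0, t}" "\<lambda>s. [:- s, 1:] :: real poly"] T(1) by (simp add: p_def)
  ultimately have "(\<Sum>s\<in>T. u s * poly p s) = 0"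
    by (intro relation_moment_curve_poly[OF e u]) simp
  moreover have "(\<Sum>s\<in>T. u s * poly p s) = (\<Sum>s\<in>{t}. u s * poly p s)"
  proof (rule sum.mono_neutral_right)
    show "\<forall>s\<in>T - {t}. u s * poly p s = 0"
    proof
      fix s assume "s \<in> T - {t}"
      then have "s = t0 \<or> s \<in> T - {t0, t}" by blast
      then show "u s * poly p s = 0"
        using T(1) t0(2) by (auto simp: p_def poly_prod prod_zero_iff)
    qed
  qed (use T(1) t in auto)
  moreover have "poly p t \<noteq> 0" using T(1) by (auto simp: p_def poly_prod prod_zero_iff)
  ultimately show ?thesis by simp
qed (use t0 in simp)

text \<open>With too few negative nodes, the square of the polynomial vanishing at them has degree
  at most \<open>CARD('n)\<close>. All its terms would be nonnegative and the one at
  \<open>t\<close> positive, yet they sum to zero.\<close>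

lemma relation_moment_curve_negative:
  fixes e :: "'n::finite \<Rightarrow> nat" and u :: "real \<Rightarrow> real"
  assumes e: "bij_betw e UNIV {1..CARD('n)}"
    and u: "(\<Sum>t\<in>T. u t) = 0" "(\<Sum>t\<in>T. u t *\<^sub>R moment_curve e t) = 0"
    and T: "finite T" and t: "t \<in> T" "0 < u t"
  shows "CARD('n) div 2 < card {t \<in> T. u t < 0}"
proof (rule ccontr)
  let ?N = "{t \<in> T. u t < 0}"
  assume "\<not> ?thesis"
  then have card: "2 * card ?N \<le> CARD('n)" by linarith
  define p :: "real poly" where "p = (\<Prod>s\<in>?N. [:- s, 1:]) ^ 2"
  have "degree (\<Prod>s\<in>?N. [:- s, 1:] :: real poly) \<le> card ?N"
    using degree_prod_sum_le[of ?N "\<lambda>s. [:- s, 1:] :: real poly"] T by simp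
  then have "degree p \<le> CARD('n)"
    using card degree_power_le[of "\<Prod>s\<in>?N. [:- s, 1:] :: real poly" 2] unfolding p_def by linarith
  then have sum: "(\<Sum>s\<in>T. u s * poly p s) = 0"
    by (rule relation_moment_curve_poly[OF e u])
  have eval: "poly p s = (\<Prod>r\<in>?N. s - r)\<^sup>2" for s by (simp add: p_def poly_prod)
  have "0 \<le> u s * poly p s" if "s \<in> T" for s
  proof (cases "s \<in> ?N")
    case True
    then have "poly p s = 0" using T by (auto simp: eval prod_zero_iff)
    then show ?thesis by simp
  qed (use that in \<open>simp add: eval\<close>)
  then have "u t * poly p t = 0" using sum T t(1) by (simp add: sum_nonneg_eq_0_iff)
  moreover have "poly p t \<noteq> 0" using T t(2) by (auto simp: eval prod_zero_iff)
  ultimately show False using t(2) by simp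
qed

section \<open>Relation data of a translated cyclic polytope\<close>

lemma dual_polytope_convex_hull: "dual_polytope (convex hull S) = {y. \<forall>v\<in>S. v \<bullet> y \<le> 1}"
proof -
  have "x \<bullet> y \<le> 1" if "\<forall>v\<in>S. v \<bullet> y \<le> 1" "x \<in> convex hull S" for x y
  proof -
    have "convex hull S \<subseteq> {x. y \<bullet> x \<le> 1}"
      using that(1) by (intro hull_minimal convex_halfspace_le) (auto simp: inner_commute)
    then show ?thesis using that(2) by (auto simp: inner_commute)
  qed
  then show ?thesis using hull_inc[of _ S convex] by (auto simp: dual_polytope_def)
qed

text \<open>The relative interior of the hull of a union of convex sets, here singletons, consists
  of strictly positive combinations.\<close>

lemma interior_convex_hull_positive:
  fixes S :: "'a::euclidean_space set"
  assumes "finite S" "0 \<in> interior (convex hull S)"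
  obtains m where "\<And>v. v \<in> S \<Longrightarrow> 0 < m v" "(\<Sum>v\<in>S. m v) = 1" "(\<Sum>v\<in>S. m v *\<^sub>R v) = 0"
proof -
  have "0 \<in> rel_interior (convex hull (\<Union>((\<lambda>v. {v}) ` S)))"
    using assms(2) interior_subset_rel_interior by auto
  also have "\<dots> = {\<Sum>v\<in>S. m v *\<^sub>R s v | m s. (\<forall>v\<in>S. 0 < m v) \<and> sum m S = 1 \<and>
      (\<forall>v\<in>S. s v \<in> rel_interior {v})}"
    using assms(1) by (intro rel_interior_convex_hull_union) auto
  finally obtain m s where m: "\<And>v. v \<in> S \<Longrightarrow> 0 < m v" "sum m S = 1"
    and s: "\<And>v. v \<in> S \<Longrightarrow> s v = v" "0 = (\<Sum>v\<in>S. m v *\<^sub>R s v)"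
    unfolding mem_Collect_eq rel_interior_sing singleton_iff by blast
  have "(\<Sum>v\<in>S. m v *\<^sub>R v) = 0" using s by (simp cong: sum.cong)
  then show ?thesis using m that by blast
qed

text \<open>The interior origin supplies \<open>m\<close>, and \<open>CARD('n) + 2\<close> points in
  dimension \<open>CARD('n)\<close> supply \<open>l\<close>. A relation vanishing at one point
  vanishes everywhere; this gives both the nonzero coefficients and uniqueness.\<close>

lemma simplicial_relation_moment_curve:
  fixes e :: "'n::finite \<Rightarrow> nat" and c :: "real ^ 'n"
  assumes e: "bij_betw e UNIV {1..CARD('n)}"
    and T: "finite T" "card T = CARD('n) + 2"
    and S: "S = (\<lambda>t. c + moment_curve e t) ` T" and int: "0 \<in> interior (convex hull S)"
  obtains l m where "simplicial_relation S l m"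
    "CARD('n) div 2 < card {v \<in> S. 0 < l v}" "CARD('n) div 2 < card {v \<in> S. l v < 0}"
proof -
  let ?q = "\<lambda>t. c + moment_curve e t"
  \<comment> \<open>Coordinate number 1 of the curve is the parameter itself, so points determine
    parameters.\<close>
  have "1 \<in> e ` UNIV" using e by (auto simp: bij_betw_def)
  then obtain i where i: "e i = 1" by force
  have inj: "inj_on ?q T"
  proof (rule inj_onI)
    fix t t' assume "?q t = ?q t'"
    then have "moment_curve e t $ i = moment_curve e t' $ i" by simp
    then show "t = t'" using i by (simp add: moment_curve_def)
  qed
  have finS: "finite S" and cardS: "card S = DIM(real ^ 'n) + 2"
    using T card_image[OF inj] by (simp_all add: S)
  \<comment> \<open>Coefficients with sum zero do not see the translation by
    \<open>c\<close>.\<close>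
  have rel: "(\<Sum>t\<in>T. w (?q t)) = 0" "(\<Sum>t\<in>T. w (?q t) *\<^sub>R moment_curve e t) = 0"
    if "(\<Sum>v\<in>S. w v) = 0" "(\<Sum>v\<in>S. w v *\<^sub>R v) = 0" for w
  proof -
    show 0: "(\<Sum>t\<in>T. w (?q t)) = 0" using that(1) by (simp add: S sum.reindex[OF inj])
    have "(\<Sum>t\<in>T. w (?q t) *\<^sub>R ?q t) = 0" using that(2) by (simp add: S sum.reindex[OF inj])
    then show "(\<Sum>t\<in>T. w (?q t) *\<^sub>R moment_curve e t) = 0"
      using 0 by (simp add: scaleR_add_right sum.distrib flip: scaleR_sum_left)
  qed
  have zero: "w v = 0"
    if "(\<Sum>v\<in>S. w v) = 0" "(\<Sum>v\<in>S. w v *\<^sub>R v) = 0" "v0 \<in> S" "w v0 = 0" "v \<in> S" for w v0 v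
  proof -
    from that(3,5) S obtain t0 t where "t0 \<in> T" "v0 = ?q t0" "t \<in> T" "v = ?q t" by auto
    then show ?thesis
      using relation_moment_curve_zero[OF e rel[OF that(1,2)] T(1) eq_refl[OF T(2)], of t0 t] that(4) by simp
  qed
  have "affine_dependent S"
    using finS cardS by (intro affine_dependent_biggerset) auto
  then obtain l where l: "(\<Sum>v\<in>S. l v) = 0" "(\<Sum>v\<in>S. l v *\<^sub>R v) = 0" "\<exists>v\<in>S. l v \<noteq> 0"
    using finS by (auto simp: affine_dependent_explicit_finite)
  have nz: "l v \<noteq> 0" if "v \<in> S" for v
    using zero[OF l(1,2) that] l(3) by blast
  obtain m where m: "\<And>v. v \<in> S \<Longrightarrow> 0 < m v" "(\<Sum>v\<in>S. m v) = 1" "(\<Sum>v\<in>S. m v *\<^sub>R v) = 0"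
    using interior_convex_hull_positive[OF finS int] by blast
  have unique: "\<exists>x. \<forall>v\<in>S. u v = x * l v"
    if u: "(\<Sum>v\<in>S. u v) = 0" "(\<Sum>v\<in>S. u v *\<^sub>R v) = 0" for u
  proof -
    obtain v0 where v0: "v0 \<in> S" using l(3) by blast
    \<comment> \<open>With this factor \<open>u - x * l\<close> vanishes at \<open>v0\<close>, hence
      everywhere by \<open>zero\<close>.\<close>
    define x where "x = u v0 / l v0"
    have "(\<Sum>v\<in>S. u v - x * l v) = 0"
      using u l by (simp add: sum_subtractf flip: sum_distrib_left)
    moreover have "(\<Sum>v\<in>S. (u v - x * l v) *\<^sub>R v) = 0"
      using u l by (simp add: scaleR_left_diff_distrib sum_subtractf flip: scaleR_scaleR scaleR_sum_right)
    ultimately have "u v - x * l v = 0" if "v \<in> S" for v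
      using zero[OF _ _ v0 _ that, of "\<lambda>v. u v - x * l v"] nz[OF v0] by (simp add: x_def)
    then show ?thesis by (intro exI[of _ x]) simp
  qed
  have "simplicial_relation S l m"
    by unfold_locales (fact finS cardS l nz m unique)+
  moreover have "CARD('n) div 2 < card {v \<in> S. w v < 0}"
    if w: "(\<Sum>v\<in>S. w v) = 0" "(\<Sum>v\<in>S. w v *\<^sub>R v) = 0" and nonzero: "\<And>v. v \<in> S \<Longrightarrow> w v \<noteq> 0" for w
  proof -
    have "\<exists>v\<in>S. 0 < w v"
    proof (rule ccontr)
      assume n: "\<not> ?thesis"
      then have "(\<Sum>v\<in>S. - w v) = 0 \<longleftrightarrow> (\<forall>v\<in>S. - w v = 0)"
        using finS by (intro sum_nonneg_eq_0_iff) (auto simp: not_less)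
      then show False using w(1) nonzero l(3) by (auto simp: sum_negf)
    qed
    then obtain t where t: "t \<in> T" "0 < w (?q t)" by (auto simp: S)
    have "CARD('n) div 2 < card {t \<in> T. w (?q t) < 0}"
      by (rule relation_moment_curve_negative[OF e rel[OF w] T(1) t])
    also have "\<dots> = card (?q ` {t \<in> T. w (?q t) < 0})"
      by (rule card_image[symmetric]) (use inj in \<open>auto intro: inj_on_subset\<close>)
    also have "?q ` {t \<in> T. w (?q t) < 0} = {v \<in> S. w v < 0}" by (auto simp: S)
    finally show ?thesis .
  qed
  \<comment> \<open>Applied to \<open>l\<close> and to \<open>- l\<close>, the bound covers both
    sign classes.\<close>
  from this[OF l(1,2) nz] this[of "\<lambda>v. - l v"]
  have "CARD('n) div 2 < card {v \<in> S. l v < 0}" "CARD('n) div 2 < card {v \<in> S. 0 < l v}"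
    using l(1,2) nz by (simp_all add: sum_negf)
  ultimately show ?thesis using that by blast
qed

subsection \<open>Linkedness of the dual polytope\<close>

context simplicial_relation
begin

lemma arc_vertex:
  assumes "u \<in> A \<times> B" "v \<in> A \<times> B" "(u, v) \<in> aligned" "u \<noteq> v"
  shows "(vertex (fst u) (snd u), vertex (fst v) (snd v)) \<in> parcs (polytope_graph Q)"
proof -
  have uv: "fst u \<in> A" "snd u \<in> B" "fst v \<in> A" "snd v \<in> B"
    using assms by (auto simp: mem_Times_iff)
  have "closed_segment (vertex (fst u) (snd u)) (vertex (fst v) (snd v)) edge_of Q"
  proof (cases "fst u = fst v")
    case True
    then show ?thesis
      using edge_vertex_left[OF uv(1,2,4)] assms(4) by (auto simp: prod_eq_iff)
  next
    case False
    then have "snd u = snd v" using assms(3) by (simp add: aligned_def)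
    then show ?thesis using edge_vertex_right[OF uv(1,2,3)] False by auto
  qed
  then show ?thesis using extreme_vertex uv by (simp add: polytope_graph_def)
qed

text \<open>A path is built backwards along the walk. If the new vertex is already on the path, the
  path is cut there; this also covers repeated cells, which \<open>aligned\<close> permits.\<close>

lemma connected_in_vpath:
  assumes "connected_in V u v" "V \<subseteq> A \<times> B"
  shows "\<exists>p. vpath p (with_proj (polytope_graph Q)) \<and> hd p = vertex (fst u) (snd u) \<and>
    last p = vertex (fst v) (snd v) \<and> set p \<subseteq> (\<lambda>z. vertex (fst z) (snd z)) ` V"
proof -
  let ?f = "\<lambda>z. vertex (fst z) (snd z)" and ?G = "with_proj (polytope_graph Q)"
  have in_G: "?f z \<in> verts ?G" if "z \<in> V" for z
    using that assms(2) extreme_vertex by (auto simp: polytope_graph_def)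
  have "(u, v) \<in> (Restr aligned V)\<^sup>*" and v: "v \<in> V"
    using assms(1) by (auto simp: connected_in_def)
  then show ?thesis
  proof (induction rule: converse_rtrancl_induct)
    case base
    then show ?case
      using in_G[OF v] v by (intro exI[of _ "[?f v]"]) (simp add: vpath_def vwalk_def)
  next
    case (step y z)
    then obtain p where p: "vpath p ?G" "hd p = ?f z" "last p = ?f v" "set p \<subseteq> ?f ` V" by blast
    have yz: "y \<in> V" "z \<in> V" "(y, z) \<in> aligned" using step.hyps by auto
    have p': "p \<noteq> []" "set p \<subseteq> verts ?G" "set (vwalk_arcs p) \<subseteq> arcs_ends ?G" "distinct p"
      using p(1) by (auto simp: vpath_def vwalk_def)
    show ?case
    proof (cases "?f y \<in> set p")
      case True
      then obtain xs ys where split: "p = xs @ ?f y # ys" by (meson split_list)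
      have "vpath (?f y # ys) ?G"
        using p' set_vwalk_arcs_append2[of "?f y # ys" xs] unfolding vpath_def vwalk_def split by auto
      then show ?thesis
        using p(3,4) by (intro exI[of _ "?f y # ys"]) (auto simp: split)
    next
      case False
      then have "?f y \<noteq> ?f z" using p(2) p'(1) by (metis hd_in_set)
      then have "(?f y, ?f z) \<in> arcs_ends ?G"
        using arc_vertex[of y z] yz assms(2) by auto
      then have "vpath (?f y # p) ?G"
        using p' False in_G[OF yz(1)] p(2) by (simp add: vpath_def vwalk_def)
      then show ?thesis
        using p(3,4) p'(1) yz(1) by (intro exI[of _ "?f y # p"]) auto
    qed
  qed
qed

text \<open>The terminals are pulled back to cells of \<open>A \<times> B\<close> and linked there;
  injectivity of \<open>vertex\<close> keeps the resulting paths disjoint.\<close>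

lemma k_linked_polytope_graph:
  assumes "k < card A" "k < card B"
  shows "k_linked k (polytope_graph Q)"
  unfolding k_linked_def
proof (intro conjI allI impI)
  let ?f = "\<lambda>z. vertex (fst z) (snd z)" and ?G = "with_proj (polytope_graph Q)"
  have finAB: "finite A" "finite B" using fin by (auto simp: A_def B_def)
  have pverts: "pverts (polytope_graph Q) = ?f ` (A \<times> B)"
    using extreme_vertex extreme_point_vertex by (force simp: polytope_graph_def)
  have inj: "inj_on ?f (A \<times> B)"
    by (rule inj_onI) (metis vertex_inj mem_Times_iff prod_eq_iff)
  have "2 * k \<le> (k + 1) * (k + 1)" by simp
  also have "\<dots> \<le> card A * card B" using assms by (intro mult_le_mono) auto
  finally show "2 * k \<le> card (pverts (polytope_graph Q))"
    unfolding pverts card_image[OF inj] by (simp add: card_cartesian_product)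
  fix X and s t :: "nat \<Rightarrow> 'a"
  assume X: "X \<subseteq> pverts (polytope_graph Q) \<and> card X = 2 * k \<and> X = s ` {..<k} \<union> t ` {..<k}"
  define w where "w \<tau> = (if snd \<tau> then t (fst \<tau>) else s (fst \<tau>))" for \<tau>
  have split: "{..<k} \<times> UNIV = (\<lambda>i. (i, False)) ` {..<k} \<union> (\<lambda>i. (i, True)) ` {..<k}"
    by (auto simp: UNIV_bool)
  have w: "w (i, False) = s i" "w (i, True) = t i" for i by (simp_all add: w_def)
  have wX: "w ` ({..<k} \<times> UNIV) = X"
    unfolding split image_Un image_image w using X by simp
  \<comment> \<open>The \<open>2 * k\<close> indices map onto a set of \<open>2 * k\<close>
    elements, so all terminals are distinct.\<close>
  have inj_on_w: "inj_on w ({..<k} \<times> UNIV)"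
  proof (rule eq_card_imp_inj_on)
    have "card X = 2 * k" using X by blast
    then show "card (w ` ({..<k} \<times> UNIV)) = card ({..<k} \<times> (UNIV :: bool set))"
      unfolding wX by (simp add: card_cartesian_product)
  qed simp
  have inj_w: "\<tau> = \<tau>'" if "w \<tau> = w \<tau>'" "fst \<tau> < k" "fst \<tau>' < k" for \<tau> \<tau>'
    using inj_onD[OF inj_on_w that(1)] that(2,3) by (simp add: mem_Times_iff)
  have "\<exists>z. z \<in> A \<times> B \<and> ?f z = w \<tau>" if "fst \<tau> < k" for \<tau>
  proof -
    have "w \<tau> \<in> ?f ` (A \<times> B)"
      using X wX that unfolding pverts by (metis imageI lessThan_iff mem_Times_iff subsetD UNIV_I)
    then obtain z where "z \<in> A \<times> B" "w \<tau> = ?f z" by (rule imageE)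
    then show ?thesis by (intro exI[of _ z]) simp
  qed
  then obtain x where x: "\<And>\<tau>. fst \<tau> < k \<Longrightarrow> x \<tau> \<in> A \<times> B \<and> ?f (x \<tau>) = w \<tau>" by metis
  have "terminals {..<k} A B x"
  proof (rule terminalsI)
    show "\<tau> = \<tau>'" if "fst \<tau> \<in> {..<k}" "fst \<tau>' \<in> {..<k}" "x \<tau> = x \<tau>'" for \<tau> \<tau>'
      using inj_w[of \<tau> \<tau>'] x[of \<tau>] x[of \<tau>'] that by auto
  qed (use finAB assms x in auto)
  then have "linked {..<k} A B x" by (rule terminals_linked)
  then obtain V where V: "\<And>i. i < k \<Longrightarrow> V i \<subseteq> A \<times> B"
      "\<And>i. i < k \<Longrightarrow> connected_in (V i) (x (i, False)) (x (i, True))"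
      "\<And>i j. i < k \<Longrightarrow> j < k \<Longrightarrow> i \<noteq> j \<Longrightarrow> V i \<inter> V j = {}"
    unfolding linked_def by (metis lessThan_iff)
  have "\<exists>p. vpath p ?G \<and> hd p = s i \<and> last p = t i \<and> set p \<subseteq> ?f ` V i" if "i < k" for i
    using connected_in_vpath[OF V(2)[OF that] V(1)[OF that]] x[of "(i, False)"] x[of "(i, True)"] that
    by (simp add: w_def)
  then obtain L where L: "\<And>i. i < k \<Longrightarrow> vpath (L i) ?G \<and> hd (L i) = s i \<and> last (L i) = t i \<and>
      set (L i) \<subseteq> ?f ` V i" by metis
  have "set (L i) \<inter> set (L j) = {}" if "i < k" "j < k" "i \<noteq> j" for i j
  proof -
    have "?f ` V i \<inter> ?f ` V j = {}"
      using V(3)[OF that] inj_on_image_Int[OF inj V(1)[OF that(1)] V(1)[OF that(2)]] by simp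
    then show ?thesis using L[OF that(1)] L[OF that(2)] by blast
  qed
  then show "\<exists>L. (\<forall>i<k. vpath (L i) ?G \<and> hd (L i) = s i \<and> last (L i) = t i) \<and>
      (\<forall>i<k. \<forall>j<k. i \<noteq> j \<longrightarrow> set (L i) \<inter> set (L j) = {})"
    using L by (intro exI[of _ L]) blast
qed

end

theorem corollary10:
  fixes e :: "'n::finite \<Rightarrow> nat" and P :: "(real ^ 'n) set" and c :: "real ^ 'n"
  assumes "2 \<le> CARD('n)"
    and "bij_betw e UNIV {1..CARD('n)}"
    and "cyclic_polytope e (CARD('n) + 2) P"
    and "0 \<in> interior ((\<lambda>x. c + x) ` P)"
  shows "linked_polytope (CARD('n) div 2) (dual_polytope ((\<lambda>x. c + x) ` P))"
proof -
  obtain S0 where S0: "S0 \<subseteq> range (moment_curve e)" "finite S0" "card S0 = CARD('n) + 2"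
      "P = convex hull S0"
    using assms(3) by (auto simp: cyclic_polytope_def)
  \<comment> \<open>One parameter is chosen for each point of \<open>S0\<close>.\<close>
  obtain T where T: "inj_on (moment_curve e) T" "S0 = moment_curve e ` T"
    using S0(1) by (auto simp: subset_image_inj)
  have finT: "finite T" "card T = CARD('n) + 2"
    using S0(2,3) T by (simp_all add: finite_image_iff card_image)
  define S where "S = (\<lambda>t. c + moment_curve e t) ` T"
  have hull: "(\<lambda>x. c + x) ` P = convex hull S"
    unfolding S0(4) T(2) S_def convex_hull_translation[symmetric] by (simp add: image_image)
  obtain l m where lm: "simplicial_relation S l m"
    "CARD('n) div 2 < card {v \<in> S. 0 < l v}" "CARD('n) div 2 < card {v \<in> S. l v < 0}"
    using simplicial_relation_moment_curve[OF assms(2) finT S_def] assms(4) unfolding hull by blast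
  interpret simplicial_relation S l m by (rule lm(1))
  show ?thesis
    unfolding hull linked_polytope_def dual_polytope_convex_hull
    using k_linked_polytope_graph lm(2,3) by (simp add: Q_def A_def B_def)
qed

end
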